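(* Let $O=\langle G,P\rangle$ be an ERDF ontology such that the ERDF triple $\mathtt{rdfs{:}subClassOf}(\mathtt{rdf{:}Property},\mathtt{erdf{:}TotalProperty})$ belongs to $G$. Then $\mathcal M^{st}(O)=\mathcal M^{H}(O)$, i.e. the stable models of $O$ are exactly the Herbrand models of $O$.
   Context: **Syntax.** $\mathcal{URI}$, $\mathcal{PL}$, $\mathcal{TL}$ are the sets of URI references, plain literals and typed literals; $\mathcal{LIT}=\mathcal{PL}\cup\mathcal{TL}$; $\mathit{Var}$ is a set of variables; $\mathcal{URI},\mathcal{LIT},\mathit{Var}$ are pairwise disjoint. A typed literal is a pair $``s"\hat{\ }\hat{\ }d$ of a string $s$ and a datatype URI $d$. A vocabulary is a subset of $\mathcal{URI}\cup\mathcal{LIT}$. A positive ERDF triple over $V$ is $p(s,o)$ with $p\in V\cap\mathcal{URI}$, $s,o\in V\cup\mathit{Var}$; a negative one is $\neg p(s,o)$; an ERDF triple is either. An ERDF graph is a set of ERDF triples over some vocabulary. $L(V)$, the set of ERDF formulas over $V$, is the smallest set containing the positive ERDF triples over $V$ and closed under $\sim F$ (weak negation), $\neg F$ (strong negation), $F\wedge G$, $F\vee G$, $F\supset G$, $\exists xF$, $\forall xF$ ($x\in\mathit{Var}$). $\mathit{Var}(\cdot)$, $\mathit{FVar}(\cdot)$ denote the variables and free variables, and $V_X$ the set of URIs and literals appearing in $X$. No variable has both free and bound occurrences in a formula, or more than one bound occurrence. **Partial interpretations.** A partial interpretation $I$ of $V$ consists of a non-empty set $Res_I$; a set $Prop_I$;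 $I_V:V\cap\mathcal{URI}\to Res_I\cup Prop_I$; $PT_I,PF_I:Prop_I\to\mathcal P(Res_I\times Res_I)$; $IL_I:V\cap\mathcal{TL}\to Res_I$; and $LV_I\subseteq Res_I$ with $V\cap\mathcal{PL}\subseteq LV_I$. The denotation $I:V\to Res_I\cup Prop_I$ is $I_V$ on URIs, the identity on plain literals, $IL_I$ on typed literals. $I$ is coherent if $PT_I(x)\cap PF_I(x)=\emptyset$ for all $x\in Prop_I$. For a valuation $v$ (partial map $\mathit{Var}\to Res_I$), $[I+v]$ is $v$ on variables and $I$ on $V$. Satisfaction $I,v\models F$ ($v:\mathit{Var}(F)\to Res_I$): $I,v\models p(s,o)$ (resp. $\neg p(s,o)$) iff $p\in V\cap\mathcal{URI}$, $s,o\in V\cup\mathit{Var}$, $I(p)\in Prop_I$ and $\langle[I+v](s),[I+v](o)\rangle\in PT_I(I(p))$ (resp. $\in PF_I(I(p))$); $I,v\models\ \sim G$ iff $V_G\subseteq V$ and $I,v\not\models G$; $\wedge,\vee$ as usual; $I,v\models F_1\supset F_2$ iff $I,v\models\ \sim F_1\vee F_2$; $I,v\models\exists xG$ (resp. $\forall xG$) iff for some (resp. all) $u:\mathit{Var}(G)\to Res_I$ agreeing with $v$ on $\mathit{Var}(G)\setminus\{x\}$, $I,u\models G$; other strongly negated formulas are rewritten by $\neg(F\wedge G)\to\neg F\vee\neg G$, $\neg(F\vee G)\to\neg F\wedge\neg G$, $\neg\neg F\to F$, $\neg\sim F\to F$, $\neg\exists xF\to\forall x\neg F$, $\neg\forall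 xF\to\exists x\neg F$, $\neg(F\supset G)\to F\wedge\neg G$. $I\models F$ iff $I,v\models F$ for all $v:\mathit{Var}(F)\to Res_I$. For an ERDF graph $G$, $I\models G$ iff there is $v:\mathit{Var}(G)\to Res_I$ with $I,v\models t$ for all $t\in G$. Always $I,v\models\mathit{true}$, $I\models\mathit{true}$, $I,v\not\models\mathit{false}$, $I\not\models\mathit{false}$. **Predefined vocabularies** (namespace prefixes rdf:, rdfs:, erdf: omitted below; $i\in\{1,2,\dots\}$). $\mathcal V_{RDF}$ (rdf:) $=\{\mathtt{type},\mathtt{Property},\mathtt{XMLLiteral},\mathtt{nil},\mathtt{List},\mathtt{Statement},\mathtt{subject},\mathtt{predicate},\mathtt{object},\mathtt{first},\mathtt{rest},\mathtt{Seq},\mathtt{Bag},\mathtt{Alt},\mathtt{value}\}\cup\{\mathtt{\_i}\}_i$. $\mathcal V_{RDFS}$ (rdfs:) $=\{\mathtt{domain},\mathtt{range},\mathtt{Resource},\mathtt{Literal},\mathtt{Datatype},\mathtt{Class},\mathtt{subClassOf},\mathtt{subPropertyOf},\mathtt{member},\mathtt{Container},\mathtt{ContainerMembershipProperty},\mathtt{comment},\mathtt{seeAlso},\mathtt{isDefinedBy},\mathtt{label}\}$. $\mathcal V_{ERDF}$ (erdf:) $=\{\mathtt{TotalClass},\mathtt{TotalProperty}\}$. **Axiomatic triples.** RDF: $\mathtt{type}(x,\mathtt{Property})$ for $x\in\{\mathtt{type},\mathtt{subject},\mathtt{predicate},\mathtt{object},\mathtt{first},\mathtt{rest},\mathtt{value},\mathtt{\_i}\}$;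 $\mathtt{type}(\mathtt{nil},\mathtt{List})$. RDFS: $\mathtt{domain}(x,\mathtt{Resource})$ for $x\in\{\mathtt{type},\mathtt{member},\mathtt{seeAlso},\mathtt{isDefinedBy},\mathtt{comment},\mathtt{label},\mathtt{value},\mathtt{\_i}\}$; $\mathtt{domain}(x,\mathtt{Property})$ for $x\in\{\mathtt{domain},\mathtt{range},\mathtt{subPropertyOf}\}$; $\mathtt{domain}(\mathtt{subClassOf},\mathtt{Class})$; $\mathtt{domain}(x,\mathtt{Statement})$ for $x\in\{\mathtt{subject},\mathtt{predicate},\mathtt{object}\}$; $\mathtt{domain}(x,\mathtt{List})$ for $x\in\{\mathtt{first},\mathtt{rest}\}$; $\mathtt{range}(x,\mathtt{Class})$ for $x\in\{\mathtt{type},\mathtt{domain},\mathtt{range},\mathtt{subClassOf}\}$; $\mathtt{range}(\mathtt{subPropertyOf},\mathtt{Property})$; $\mathtt{range}(x,\mathtt{Resource})$ for $x\in\{\mathtt{subject},\mathtt{predicate},\mathtt{object},\mathtt{member},\mathtt{first},\mathtt{seeAlso},\mathtt{isDefinedBy},\mathtt{value},\mathtt{\_i}\}$; $\mathtt{range}(\mathtt{rest},\mathtt{List})$; $\mathtt{range}(x,\mathtt{Literal})$ for $x\in\{\mathtt{comment},\mathtt{label}\}$; $\mathtt{subClassOf}(x,\mathtt{Container})$ for $x\in\{\mathtt{Alt},\mathtt{Bag},\mathtt{Seq}\}$; $\mathtt{subClassOf}(\mathtt{ContainerMembershipProperty},\mathtt{Property})$; $\mathtt{subClassOf}(\mathtt{XMLLiteral},\mathtt{Literal})$;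 $\mathtt{subClassOf}(\mathtt{Datatype},\mathtt{Class})$; $\mathtt{subPropertyOf}(\mathtt{isDefinedBy},\mathtt{seeAlso})$; $\mathtt{type}(\mathtt{XMLLiteral},\mathtt{Datatype})$; $\mathtt{type}(\mathtt{\_i},\mathtt{ContainerMembershipProperty})$. ERDF: $\mathtt{subClassOf}(\mathtt{TotalClass},\mathtt{Class})$; $\mathtt{subClassOf}(\mathtt{TotalProperty},\mathtt{Property})$. **ERDF interpretation** of $V$: a coherent partial interpretation $I$ of $V'=V\cup\mathcal V_{RDF}\cup\mathcal V_{RDFS}\cup\mathcal V_{ERDF}$ (satisfaction is with respect to $V'$), with sets $Cls_I\subseteq Res_I$, $TCls_I\subseteq Cls_I$, $TProp_I\subseteq Prop_I$ and maps $CT_I,CF_I:Cls_I\to\mathcal P(Res_I)$ such that: (1) $x\in CT_I(y)$ iff $\langle x,y\rangle\in PT_I(I(\mathtt{type}))$; $x\in CF_I(y)$ iff $\langle x,y\rangle\in PF_I(I(\mathtt{type}))$. (2) $Prop_I,Cls_I,Res_I,LV_I,TCls_I,TProp_I$ equal $CT_I(I(c))$ for $c=\mathtt{Property},\mathtt{Class},\mathtt{Resource},\mathtt{Literal},\mathtt{TotalClass},\mathtt{TotalProperty}$ respectively. (3) If $\langle x,y\rangle\in PT_I(I(\mathtt{domain}))$ and $\langle z,w\rangle\in PT_I(x)$ then $z\in CT_I(y)$; if $\langle x,y\rangle\in PT_I(I(\mathtt{range}))$ and $\langle z,w\rangle\in PT_I(x)$ then $w\in CT_I(y)$. (4) $x\in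 Cls_I$ implies $\langle x,I(\mathtt{Resource})\rangle\in PT_I(I(\mathtt{subClassOf}))$. (5) $\langle x,y\rangle\in PT_I(I(\mathtt{subClassOf}))$ implies $x,y\in Cls_I$, $CT_I(x)\subseteq CT_I(y)$, $CF_I(y)\subseteq CF_I(x)$; $PT_I(I(\mathtt{subClassOf}))$ is reflexive and transitive on $Cls_I$. (6) $\langle x,y\rangle\in PT_I(I(\mathtt{subPropertyOf}))$ implies $x,y\in Prop_I$, $PT_I(x)\subseteq PT_I(y)$, $PF_I(y)\subseteq PF_I(x)$; $PT_I(I(\mathtt{subPropertyOf}))$ is reflexive and transitive on $Prop_I$. (7) $x\in CT_I(I(\mathtt{Datatype}))$ implies $\langle x,I(\mathtt{Literal})\rangle\in PT_I(I(\mathtt{subClassOf}))$; $x\in CT_I(I(\mathtt{ContainerMembershipProperty}))$ implies $\langle x,I(\mathtt{member})\rangle\in PT_I(I(\mathtt{subPropertyOf}))$. (8) $x\in TCls_I$ implies $CT_I(x)\cup CF_I(x)=Res_I$; $x\in TProp_I$ implies $PT_I(x)\cup PF_I(x)=Res_I\times Res_I$. (9) If $l=``s"\hat{\ }\hat{\ }\mathtt{XMLLiteral}\in V$ with $s$ a well-typed XML literal string, then $IL_I(l)$ is the XML value of $s$ and lies in $CT_I(I(\mathtt{XMLLiteral}))$; if $s$ is ill-typed, $IL_I(l)\in Res_I\setminus LV_I$ and $IL_I(l)\in CF_I(I(\mathtt{Literal}))$ (well-typedness and XML values as in the W3C RDF Recommendation). (10) $I$ satisfies all axiomatic triples above. **ERDF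 ontologies.** An ERDF rule $r$ over $V$ is $G\leftarrow F$ with $\mathit{Cond}(r)=F\in L(V)\cup\{\mathit{true}\}$ and $\mathit{Concl}(r)=G$ an ERDF triple over $V$ or $\mathit{false}$, no bound variable of $F$ occurring free in $G$; $\mathit{FVar}(r)=\mathit{FVar}(F)\cup\mathit{FVar}(G)$. An ERDF program is a set of ERDF rules over some vocabulary. An ERDF ontology is a pair $O=\langle G,P\rangle$ of an ERDF graph and an ERDF program. $I\models r$ iff for all $v:\mathit{Var}(r)\to Res_I$ with $I,v\models\mathit{Cond}(r)$, $I,v\models\mathit{Concl}(r)$; $I\models\langle G,P\rangle$ iff $I\models G$ and $I\models r$ for all $r\in P$. The skolemization function $sk_G:\mathit{Var}(G)\to\mathcal{URI}$ is injective with values in artificial (fresh) URIs; $sk(G)$ is $G$ with each variable $x$ replaced by $sk_G(x)$. $V_O=V_{sk(G)}\cup V_P\cup\mathcal V_{RDF}\cup\mathcal V_{RDFS}\cup\mathcal V_{ERDF}$. $Res^H_O$ is the union of $V_O$ and the set of XML values of the well-typed XML literals in $V_O$, minus the well-typed XML literals. **Herbrand interpretations and models.** A Herbrand interpretation of $O$ is an ERDF interpretation $I$ of $V_O$ with $Res_I=Res^H_O$; $I_V(x)=x$ for $x\in V_O\cap\mathcal{URI}$; $IL_I(x)=x$ for typed literals $x\in V_O$ that are not well-typed XML literals, and $IL_I(x)$ the XML value of $x$ for well-typed XML literals. $\mathcal I^H(O)$ is the set of these; $\mathcal M^H(O)=\{I\in\mathcal I^H(O): I\models\langle sk(G),P\rangle\}$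 is the set of Herbrand models. For $I,J\in\mathcal I^H(O)$: $I\le J$ iff $Prop_I\subseteq Prop_J$ and $PT_I(p)\subseteq PT_J(p)$, $PF_I(p)\subseteq PF_J(p)$ for all $p\in Prop_I$. For $\mathcal I\subseteq\mathcal I^H(O)$, $minimal(\mathcal I)=\{I\in\mathcal I:\nexists J\in\mathcal I,\ J\ne I,\ J\le I\}$. **Stable models.** $[r]_V$ is the set of rules obtained from $r$ by replacing each $x\in\mathit{FVar}(r)$ by $v(x)$, over all $v:\mathit{FVar}(r)\to V$; $[P]_V=\bigcup_{r\in P}[r]_V$. $M\in\mathcal I^H(O)$ is a stable model of $O$ iff there is a (finite) chain $I_0\le\dots\le I_{k+1}$ in $\mathcal I^H(O)$ with $I_k=I_{k+1}=M$ such that $I_0\in minimal(\{I\in\mathcal I^H(O): I\models sk(G)\})$ and, for $0<\alpha\le k+1$, $I_\alpha\in minimal(\{I\in\mathcal I^H(O): I\ge I_{\alpha-1}\text{ and }I\models\mathit{Concl}(r)\ \forall r\in P_{[I_{\alpha-1},M]}\})$, where $P_{[I_{\alpha-1},M]}=\{r\in[P]_{V_O}: I\models\mathit{Cond}(r)\ \forall I\in\mathcal I^H(O)\text{ with }I_{\alpha-1}\le I\le M\}$. $\mathcal M^{st}(O)$ is the set of stable models of $O$. *)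

theory Defs
  imports Main "HOL-Library.FuncSet"
begin

section \<open>Symbols and vocabularies\<close>

text \<open>
  The URI references are the predefined ones plus an arbitrary type \<^typ>\<open>'u\<close> of further ones.
  \<open>rdf_ord i\<close> is the container membership property \<open>rdf:_i\<close>; it belongs to the RDF vocabulary
  only for \<open>i \<ge> 1\<close>.
\<close>

datatype 'u uri =
    rdf_type | rdf_Property | rdf_XMLLiteral | rdf_nil | rdf_List | rdf_Statement
  | rdf_subject | rdf_predicate | rdf_object | rdf_first | rdf_rest | rdf_Seq | rdf_Bag
  | rdf_Alt | rdf_value | rdf_ord nat
  | rdfs_domain | rdfs_range | rdfs_Resource | rdfs_Literal | rdfs_Datatype | rdfs_Class
  | rdfs_subClassOf | rdfs_subPropertyOf | rdfs_member | rdfs_Container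
  | rdfs_ContainerMembershipProperty | rdfs_comment | rdfs_seeAlso | rdfs_isDefinedBy
  | rdfs_label
  | erdf_TotalClass | erdf_TotalProperty
  | Other_uri 'u

text \<open>A plain literal is a string with an optional language tag.\<close>

type_synonym plit = "string \<times> string option"
type_synonym 'u tlit = "string \<times> 'u uri"

datatype 'u symbol = URI "'u uri" | PL plit | TL "'u tlit"

definition V_RDF :: "'u symbol set" where
  "V_RDF = URI ` ({rdf_type, rdf_Property, rdf_XMLLiteral, rdf_nil, rdf_List, rdf_Statement,
     rdf_subject, rdf_predicate, rdf_object, rdf_first, rdf_rest, rdf_Seq, rdf_Bag, rdf_Alt,
     rdf_value} \<union> {rdf_ord i | i. i \<ge> 1})"

definition V_RDFS :: "'u symbol set" where
  "V_RDFS = URI ` {rdfs_domain, rdfs_range, rdfs_Resource, rdfs_Literal, rdfs_Datatype,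
     rdfs_Class, rdfs_subClassOf, rdfs_subPropertyOf, rdfs_member, rdfs_Container,
     rdfs_ContainerMembershipProperty, rdfs_comment, rdfs_seeAlso, rdfs_isDefinedBy, rdfs_label}"

definition V_ERDF :: "'u symbol set" where
  "V_ERDF = URI ` {erdf_TotalClass, erdf_TotalProperty}"

section \<open>Triples, formulas, rules, ontologies\<close>

datatype ('u, 'x) trm = Var 'x | Sym "'u symbol"

datatype ('u, 'x) triple =
    Pos "'u uri" "('u, 'x) trm" "('u, 'x) trm"
  | Neg "'u uri" "('u, 'x) trm" "('u, 'x) trm"

text \<open>\<open>WNeg\<close> is weak negation, \<open>SNeg\<close> strong negation.\<close>

datatype ('u, 'x) form =
    Triple "'u uri" "('u, 'x) trm" "('u, 'x) trm"
  | WNeg "('u, 'x) form"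
  | SNeg "('u, 'x) form"
  | Conj "('u, 'x) form" "('u, 'x) form"
  | Disj "('u, 'x) form" "('u, 'x) form"
  | Impl "('u, 'x) form" "('u, 'x) form"
  | Exi 'x "('u, 'x) form"
  | Uni 'x "('u, 'x) form"

fun form_of :: "('u, 'x) triple \<Rightarrow> ('u, 'x) form" where
  "form_of (Pos p s t) = Triple p s t"
| "form_of (Neg p s t) = SNeg (Triple p s t)"

fun vars_trm :: "('u, 'x) trm \<Rightarrow> 'x set" where
  "vars_trm (Var x) = {x}"
| "vars_trm (Sym c) = {}"

fun syms_trm :: "('u, 'x) trm \<Rightarrow> 'u symbol set" where
  "syms_trm (Var x) = {}"
| "syms_trm (Sym c) = {c}"

fun vars :: "('u, 'x) form \<Rightarrow> 'x set" where
  "vars (Triple p s t) = vars_trm s \<union> vars_trm t"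
| "vars (WNeg F) = vars F"
| "vars (SNeg F) = vars F"
| "vars (Conj F G) = vars F \<union> vars G"
| "vars (Disj F G) = vars F \<union> vars G"
| "vars (Impl F G) = vars F \<union> vars G"
| "vars (Exi x F) = insert x (vars F)"
| "vars (Uni x F) = insert x (vars F)"

fun fvars :: "('u, 'x) form \<Rightarrow> 'x set" where
  "fvars (Triple p s t) = vars_trm s \<union> vars_trm t"
| "fvars (WNeg F) = fvars F"
| "fvars (SNeg F) = fvars F"
| "fvars (Conj F G) = fvars F \<union> fvars G"
| "fvars (Disj F G) = fvars F \<union> fvars G"
| "fvars (Impl F G) = fvars F \<union> fvars G"
| "fvars (Exi x F) = fvars F - {x}"
| "fvars (Uni x F) = fvars F - {x}"

text \<open>The quantified variables, listed with one entry per quantifier occurrence.\<close>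

fun binders :: "('u, 'x) form \<Rightarrow> 'x list" where
  "binders (Triple p s t) = []"
| "binders (WNeg F) = binders F"
| "binders (SNeg F) = binders F"
| "binders (Conj F G) = binders F @ binders G"
| "binders (Disj F G) = binders F @ binders G"
| "binders (Impl F G) = binders F @ binders G"
| "binders (Exi x F) = x # binders F"
| "binders (Uni x F) = x # binders F"

fun syms :: "('u, 'x) form \<Rightarrow> 'u symbol set" where
  "syms (Triple p s t) = insert (URI p) (syms_trm s \<union> syms_trm t)"
| "syms (WNeg F) = syms F"
| "syms (SNeg F) = syms F"
| "syms (Conj F G) = syms F \<union> syms G"
| "syms (Disj F G) = syms F \<union> syms G"
| "syms (Impl F G) = syms F \<union> syms G"
| "syms (Exi x F) = syms F"
| "syms (Uni x F) = syms F"

text \<open>No variable is both free and bound, and none is bound by two quantifier occurrences.\<close>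

definition wf_form :: "('u, 'x) form \<Rightarrow> bool" where
  "wf_form F \<longleftrightarrow> distinct (binders F) \<and> set (binders F) \<inter> fvars F = {}"

datatype ('u, 'x) body = BTrue | BForm "('u, 'x) form"
datatype ('u, 'x) head = HFalse | HTriple "('u, 'x) triple"
datatype ('u, 'x) rule = Rule (Concl: "('u, 'x) head") (Cond: "('u, 'x) body")

fun body_vars :: "('u, 'x) body \<Rightarrow> 'x set" where
  "body_vars BTrue = {}"
| "body_vars (BForm F) = vars F"

fun body_fvars :: "('u, 'x) body \<Rightarrow> 'x set" where
  "body_fvars BTrue = {}"
| "body_fvars (BForm F) = fvars F"

fun binders_body :: "('u, 'x) body \<Rightarrow> 'x list" where
  "binders_body BTrue = []"
| "binders_body (BForm F) = binders F"

fun wf_body :: "('u, 'x) body \<Rightarrow> bool" where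
  "wf_body BTrue = True"
| "wf_body (BForm F) = wf_form F"

fun body_syms :: "('u, 'x) body \<Rightarrow> 'u symbol set" where
  "body_syms BTrue = {}"
| "body_syms (BForm F) = syms F"

fun head_vars :: "('u, 'x) head \<Rightarrow> 'x set" where
  "head_vars HFalse = {}"
| "head_vars (HTriple t) = vars (form_of t)"

fun head_syms :: "('u, 'x) head \<Rightarrow> 'u symbol set" where
  "head_syms HFalse = {}"
| "head_syms (HTriple t) = syms (form_of t)"

definition rule_vars :: "('u, 'x) rule \<Rightarrow> 'x set" where
  "rule_vars r = body_vars (Cond r) \<union> head_vars (Concl r)"

definition rule_fvars :: "('u, 'x) rule \<Rightarrow> 'x set" where
  "rule_fvars r = body_fvars (Cond r) \<union> head_vars (Concl r)"

definition wf_rule :: "('u, 'x) rule \<Rightarrow> bool" where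
  "wf_rule r \<longleftrightarrow> wf_body (Cond r) \<and> set (binders_body (Cond r)) \<inter> head_vars (Concl r) = {}"

type_synonym ('u, 'x) graph = "('u, 'x) triple set"
type_synonym ('u, 'x) program = "('u, 'x) rule set"
type_synonym ('u, 'x) ontology = "('u, 'x) graph \<times> ('u, 'x) program"

definition erdf_ontology :: "('u, 'x) ontology \<Rightarrow> bool" where
  "erdf_ontology Ont \<longleftrightarrow> (\<forall>r \<in> snd Ont. wf_rule r)"

definition graph_vars :: "('u, 'x) graph \<Rightarrow> 'x set" where
  "graph_vars G = (\<Union>t\<in>G. vars (form_of t))"

definition graph_syms :: "('u, 'x) graph \<Rightarrow> 'u symbol set" where
  "graph_syms G = (\<Union>t\<in>G. syms (form_of t))"

definition program_syms :: "('u, 'x) program \<Rightarrow> 'u symbol set" where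
  "program_syms P = (\<Union>r\<in>P. body_syms (Cond r) \<union> head_syms (Concl r))"

section \<open>Substitution, grounding, skolemization\<close>

fun subst_trm :: "('x \<rightharpoonup> 'u symbol) \<Rightarrow> ('u, 'x) trm \<Rightarrow> ('u, 'x) trm" where
  "subst_trm \<theta> (Var x) = (case \<theta> x of None \<Rightarrow> Var x | Some c \<Rightarrow> Sym c)"
| "subst_trm \<theta> (Sym c) = Sym c"

fun subst_triple :: "('x \<rightharpoonup> 'u symbol) \<Rightarrow> ('u, 'x) triple \<Rightarrow> ('u, 'x) triple" where
  "subst_triple \<theta> (Pos p s t) = Pos p (subst_trm \<theta> s) (subst_trm \<theta> t)"
| "subst_triple \<theta> (Neg p s t) = Neg p (subst_trm \<theta> s) (subst_trm \<theta> t)"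

fun subst_form :: "('x \<rightharpoonup> 'u symbol) \<Rightarrow> ('u, 'x) form \<Rightarrow> ('u, 'x) form" where
  "subst_form \<theta> (Triple p s t) = Triple p (subst_trm \<theta> s) (subst_trm \<theta> t)"
| "subst_form \<theta> (WNeg F) = WNeg (subst_form \<theta> F)"
| "subst_form \<theta> (SNeg F) = SNeg (subst_form \<theta> F)"
| "subst_form \<theta> (Conj F G) = Conj (subst_form \<theta> F) (subst_form \<theta> G)"
| "subst_form \<theta> (Disj F G) = Disj (subst_form \<theta> F) (subst_form \<theta> G)"
| "subst_form \<theta> (Impl F G) = Impl (subst_form \<theta> F) (subst_form \<theta> G)"
| "subst_form \<theta> (Exi x F) = Exi x (subst_form (\<theta>(x := None)) F)"
| "subst_form \<theta> (Uni x F) = Uni x (subst_form (\<theta>(x := None)) F)"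

fun subst_body :: "('x \<rightharpoonup> 'u symbol) \<Rightarrow> ('u, 'x) body \<Rightarrow> ('u, 'x) body" where
  "subst_body \<theta> BTrue = BTrue"
| "subst_body \<theta> (BForm F) = BForm (subst_form \<theta> F)"

fun subst_head :: "('x \<rightharpoonup> 'u symbol) \<Rightarrow> ('u, 'x) head \<Rightarrow> ('u, 'x) head" where
  "subst_head \<theta> HFalse = HFalse"
| "subst_head \<theta> (HTriple t) = HTriple (subst_triple \<theta> t)"

definition ground_rule :: "'u symbol set \<Rightarrow> ('u, 'x) rule \<Rightarrow> ('u, 'x) rule set" where
  "ground_rule V r =
     {Rule (subst_head \<theta> (Concl r)) (subst_body \<theta> (Cond r)) | \<theta>.
        dom \<theta> = rule_fvars r \<and> ran \<theta> \<subseteq> V}"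

definition ground_program :: "'u symbol set \<Rightarrow> ('u, 'x) program \<Rightarrow> ('u, 'x) program" where
  "ground_program V P = (\<Union>r\<in>P. ground_rule V r)"

definition skolemize :: "('x \<Rightarrow> 'u uri) \<Rightarrow> ('u, 'x) graph \<Rightarrow> ('u, 'x) graph" where
  "skolemize sk G = subst_triple (\<lambda>x. Some (URI (sk x))) ` G"

text \<open>
  \<open>sk\<close> is only relevant on the variables of the graph. Its values there are fresh: they occur
  neither in the ontology nor among the predefined URIs.
\<close>

definition skolemization :: "('x \<Rightarrow> 'u uri) \<Rightarrow> ('u, 'x) ontology \<Rightarrow> bool" where
  "skolemization sk Ont \<longleftrightarrow>
     inj_on sk (graph_vars (fst Ont)) \<and>
     (\<forall>x \<in> graph_vars (fst Ont).
        URI (sk x) \<notin> graph_syms (fst Ont) \<union> program_syms (snd Ont) \<union> V_RDF \<union> V_RDFS \<union> V_ERDF)"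

definition voc_ont :: "('x \<Rightarrow> 'u uri) \<Rightarrow> ('u, 'x) ontology \<Rightarrow> 'u symbol set" where
  "voc_ont sk Ont =
     graph_syms (skolemize sk (fst Ont)) \<union> program_syms (snd Ont) \<union> V_RDF \<union> V_RDFS \<union> V_ERDF"

section \<open>Partial interpretations\<close>

text \<open>
  Interpretations are over a universe that contains the symbols themselves (plain literals denote
  themselves, and Herbrand interpretations need the other symbols too), the XML values, and
  arbitrary further individuals. By the RDF Recommendation the XML values are in one-to-one
  correspondence with the well-typed XML literal strings and differ from all strings and literals;
  so the XML value of \<open>s\<close> is represented by \<open>XMLVal s\<close>.
\<close>

datatype ('u, 'e) entity = Sy "'u symbol" | XMLVal string | Individual 'e

text \<open>\<open>Voc\<close> is the vocabulary interpreted, over which satisfaction is evaluated.\<close>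

record ('u, 'e) pinterp =
  Voc :: "'u symbol set"
  Res :: "('u, 'e) entity set"
  Prop :: "('u, 'e) entity set"
  IV :: "'u uri \<Rightarrow> ('u, 'e) entity"
  PT :: "('u, 'e) entity \<Rightarrow> (('u, 'e) entity \<times> ('u, 'e) entity) set"
  PF :: "('u, 'e) entity \<Rightarrow> (('u, 'e) entity \<times> ('u, 'e) entity) set"
  IL :: "'u tlit \<Rightarrow> ('u, 'e) entity"
  LV :: "('u, 'e) entity set"

text \<open>
  The maps are made canonical outside their domains, so that equality of records is equality of
  interpretations: \<open>PT\<close> and \<open>PF\<close> are empty there, so that membership in an undefined extension
  is false; \<open>IV\<close> and \<open>IL\<close> are \<^term>\<open>undefined\<close> there.
\<close>

definition partial_interp :: "('u, 'e, 'z) pinterp_scheme \<Rightarrow> bool" where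
  "partial_interp I \<longleftrightarrow>
     Res I \<noteq> {} \<and>
     IV I \<in> {u. URI u \<in> Voc I} \<rightarrow>\<^sub>E Res I \<union> Prop I \<and>
     PT I \<in> Prop I \<rightarrow> Pow (Res I \<times> Res I) \<and> (\<forall>x. x \<notin> Prop I \<longrightarrow> PT I x = {}) \<and>
     PF I \<in> Prop I \<rightarrow> Pow (Res I \<times> Res I) \<and> (\<forall>x. x \<notin> Prop I \<longrightarrow> PF I x = {}) \<and>
     IL I \<in> {l. TL l \<in> Voc I} \<rightarrow>\<^sub>E Res I \<and>
     LV I \<subseteq> Res I \<and>
     {Sy (PL l) | l. PL l \<in> Voc I} \<subseteq> LV I"

definition coherent :: "('u, 'e, 'z) pinterp_scheme \<Rightarrow> bool" where
  "coherent I \<longleftrightarrow> (\<forall>x \<in> Prop I. PT I x \<inter> PF I x = {})"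

fun den :: "('u, 'e, 'z) pinterp_scheme \<Rightarrow> 'u symbol \<Rightarrow> ('u, 'e) entity" where
  "den I (URI u) = IV I u"
| "den I (PL l) = Sy (PL l)"
| "den I (TL l) = IL I l"

fun den_trm :: "('u, 'e, 'z) pinterp_scheme \<Rightarrow> ('x \<Rightarrow> ('u, 'e) entity) \<Rightarrow> ('u, 'x) trm
    \<Rightarrow> ('u, 'e) entity" where
  "den_trm I v (Var x) = v x"
| "den_trm I v (Sym c) = den I c"

section \<open>Satisfaction\<close>

text \<open>Termination measure for satisfaction, which rewrites \<open>Impl\<close> and strong negations.\<close>

fun weight :: "('u, 'x) form \<Rightarrow> nat" where
  "weight (Triple p s t) = 1"
| "weight (WNeg F) = 1 + weight F"
| "weight (SNeg F) = 3 * weight F"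
| "weight (Conj F G) = 1 + weight F + weight G"
| "weight (Disj F G) = 1 + weight F + weight G"
| "weight (Impl F G) = 3 + weight F + weight G"
| "weight (Exi x F) = 1 + weight F"
| "weight (Uni x F) = 1 + weight F"

lemma weight_pos: "0 < weight F"
  by (induction F) auto

text \<open>
  A valuation is a total function of which only the values on the variables of the formula matter;
  \<^term>\<open>sat I v F\<close> is meant for \<^term>\<open>v \<in> vars F \<rightarrow> Res I\<close>.
\<close>

function sat :: "('u, 'e, 'z) pinterp_scheme \<Rightarrow> ('x \<Rightarrow> ('u, 'e) entity) \<Rightarrow> ('u, 'x) form \<Rightarrow> bool"
where
  "sat I v (Triple p s t) \<longleftrightarrow>
     URI p \<in> Voc I \<and> syms_trm s \<subseteq> Voc I \<and> syms_trm t \<subseteq> Voc I \<and>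
     IV I p \<in> Prop I \<and> (den_trm I v s, den_trm I v t) \<in> PT I (IV I p)"
| "sat I v (SNeg (Triple p s t)) \<longleftrightarrow>
     URI p \<in> Voc I \<and> syms_trm s \<subseteq> Voc I \<and> syms_trm t \<subseteq> Voc I \<and>
     IV I p \<in> Prop I \<and> (den_trm I v s, den_trm I v t) \<in> PF I (IV I p)"
| "sat I v (WNeg F) \<longleftrightarrow> syms F \<subseteq> Voc I \<and> \<not> sat I v F"
| "sat I v (Conj F G) \<longleftrightarrow> sat I v F \<and> sat I v G"
| "sat I v (Disj F G) \<longleftrightarrow> sat I v F \<or> sat I v G"
| "sat I v (Impl F G) \<longleftrightarrow> sat I v (Disj (WNeg F) G)"
| "sat I v (Exi x F) \<longleftrightarrow>
     (\<exists>u \<in> vars F \<rightarrow> Res I. (\<forall>y \<in> vars F - {x}. u y = v y) \<and> sat I u F)"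
| "sat I v (Uni x F) \<longleftrightarrow>
     (\<forall>u \<in> vars F \<rightarrow> Res I. (\<forall>y \<in> vars F - {x}. u y = v y) \<longrightarrow> sat I u F)"
| "sat I v (SNeg (Conj F G)) \<longleftrightarrow> sat I v (Disj (SNeg F) (SNeg G))"
| "sat I v (SNeg (Disj F G)) \<longleftrightarrow> sat I v (Conj (SNeg F) (SNeg G))"
| "sat I v (SNeg (SNeg F)) \<longleftrightarrow> sat I v F"
| "sat I v (SNeg (WNeg F)) \<longleftrightarrow> sat I v F"
| "sat I v (SNeg (Exi x F)) \<longleftrightarrow> sat I v (Uni x (SNeg F))"
| "sat I v (SNeg (Uni x F)) \<longleftrightarrow> sat I v (Exi x (SNeg F))"
| "sat I v (SNeg (Impl F G)) \<longleftrightarrow> sat I v (Conj F (SNeg G))"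
  by pat_completeness auto
termination
  by (relation "measure (\<lambda>(I, v, F). weight F)") (auto simp: weight_pos)

fun sat_body :: "('u, 'e, 'z) pinterp_scheme \<Rightarrow> ('x \<Rightarrow> ('u, 'e) entity) \<Rightarrow> ('u, 'x) body \<Rightarrow> bool"
where
  "sat_body I v BTrue \<longleftrightarrow> True"
| "sat_body I v (BForm F) \<longleftrightarrow> sat I v F"

fun sat_head :: "('u, 'e, 'z) pinterp_scheme \<Rightarrow> ('x \<Rightarrow> ('u, 'e) entity) \<Rightarrow> ('u, 'x) head \<Rightarrow> bool"
where
  "sat_head I v HFalse \<longleftrightarrow> False"
| "sat_head I v (HTriple t) \<longleftrightarrow> sat I v (form_of t)"

definition models_form :: "('u, 'e, 'z) pinterp_scheme \<Rightarrow> ('u, 'x) form \<Rightarrow> bool" where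
  "models_form I F \<longleftrightarrow> (\<forall>v \<in> vars F \<rightarrow> Res I. sat I v F)"

fun models_body :: "('u, 'e, 'z) pinterp_scheme \<Rightarrow> ('u, 'x) body \<Rightarrow> bool" where
  "models_body I BTrue \<longleftrightarrow> True"
| "models_body I (BForm F) \<longleftrightarrow> models_form I F"

fun models_head :: "('u, 'e, 'z) pinterp_scheme \<Rightarrow> ('u, 'x) head \<Rightarrow> bool" where
  "models_head I HFalse \<longleftrightarrow> False"
| "models_head I (HTriple t) \<longleftrightarrow> models_form I (form_of t)"

definition models_graph :: "('u, 'e, 'z) pinterp_scheme \<Rightarrow> ('u, 'x) graph \<Rightarrow> bool" where
  "models_graph I G \<longleftrightarrow> (\<exists>v \<in> graph_vars G \<rightarrow> Res I. \<forall>t \<in> G. sat I v (form_of t))"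

definition models_rule :: "('u, 'e, 'z) pinterp_scheme \<Rightarrow> ('u, 'x) rule \<Rightarrow> bool" where
  "models_rule I r \<longleftrightarrow>
     (\<forall>v \<in> rule_vars r \<rightarrow> Res I. sat_body I v (Cond r) \<longrightarrow> sat_head I v (Concl r))"

definition models_ontology :: "('u, 'e, 'z) pinterp_scheme \<Rightarrow> ('u, 'x) ontology \<Rightarrow> bool" where
  "models_ontology I Ont \<longleftrightarrow> models_graph I (fst Ont) \<and> (\<forall>r \<in> snd Ont. models_rule I r)"

section \<open>ERDF interpretations\<close>

text \<open>The axiomatic triples contain no variables; \<^typ>\<open>unit\<close> is a dummy type of variables.\<close>

abbreviation gtriple :: "'u uri \<Rightarrow> 'u uri \<Rightarrow> 'u uri \<Rightarrow> ('u, unit) triple" where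
  "gtriple p s t \<equiv> Pos p (Sym (URI s)) (Sym (URI t))"

abbreviation ords :: "'u uri set" where
  "ords \<equiv> {rdf_ord i | i. i \<ge> 1}"

definition rdf_axioms :: "('u, unit) triple set" where
  "rdf_axioms =
     {gtriple rdf_type x rdf_Property | x. x \<in> {rdf_type, rdf_subject, rdf_predicate, rdf_object,
        rdf_first, rdf_rest, rdf_value} \<union> ords} \<union>
     {gtriple rdf_type rdf_nil rdf_List}"

definition rdfs_axioms :: "('u, unit) triple set" where
  "rdfs_axioms =
     {gtriple rdfs_domain x rdfs_Resource | x. x \<in> {rdf_type, rdfs_member, rdfs_seeAlso,
        rdfs_isDefinedBy, rdfs_comment, rdfs_label, rdf_value} \<union> ords} \<union>
     {gtriple rdfs_domain x rdf_Property | x. x \<in> {rdfs_domain, rdfs_range, rdfs_subPropertyOf}} \<union>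
     {gtriple rdfs_domain rdfs_subClassOf rdfs_Class} \<union>
     {gtriple rdfs_domain x rdf_Statement | x. x \<in> {rdf_subject, rdf_predicate, rdf_object}} \<union>
     {gtriple rdfs_domain x rdf_List | x. x \<in> {rdf_first, rdf_rest}} \<union>
     {gtriple rdfs_range x rdfs_Class | x. x \<in> {rdf_type, rdfs_domain, rdfs_range,
        rdfs_subClassOf}} \<union>
     {gtriple rdfs_range rdfs_subPropertyOf rdf_Property} \<union>
     {gtriple rdfs_range x rdfs_Resource | x. x \<in> {rdf_subject, rdf_predicate, rdf_object,
        rdfs_member, rdf_first, rdfs_seeAlso, rdfs_isDefinedBy, rdf_value} \<union> ords} \<union>
     {gtriple rdfs_range rdf_rest rdf_List} \<union>
     {gtriple rdfs_range x rdfs_Literal | x. x \<in> {rdfs_comment, rdfs_label}} \<union>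
     {gtriple rdfs_subClassOf x rdfs_Container | x. x \<in> {rdf_Alt, rdf_Bag, rdf_Seq}} \<union>
     {gtriple rdfs_subClassOf rdfs_ContainerMembershipProperty rdf_Property,
      gtriple rdfs_subClassOf rdf_XMLLiteral rdfs_Literal,
      gtriple rdfs_subClassOf rdfs_Datatype rdfs_Class,
      gtriple rdfs_subPropertyOf rdfs_isDefinedBy rdfs_seeAlso,
      gtriple rdf_type rdf_XMLLiteral rdfs_Datatype} \<union>
     {gtriple rdf_type x rdfs_ContainerMembershipProperty | x. x \<in> ords}"

definition erdf_axioms :: "('u, unit) triple set" where
  "erdf_axioms =
     {gtriple rdfs_subClassOf erdf_TotalClass rdfs_Class,
      gtriple rdfs_subClassOf erdf_TotalProperty rdf_Property}"

record ('u, 'e) einterp = "('u, 'e) pinterp" +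
  Cls :: "('u, 'e) entity set"
  TCls :: "('u, 'e) entity set"
  TProp :: "('u, 'e) entity set"
  CT :: "('u, 'e) entity \<Rightarrow> ('u, 'e) entity set"
  CF :: "('u, 'e) entity \<Rightarrow> ('u, 'e) entity set"

text \<open>
  The parameter \<open>wt\<close> says which strings are well-typed XML literal strings; it is left arbitrary.
  As with \<open>PT\<close> and \<open>PF\<close>, the maps \<open>CT\<close> and \<open>CF\<close> are empty outside their domain \<open>Cls\<close>, and the
  equivalences that tie them to \<open>rdf:type\<close> are required on that domain. (For \<open>CT\<close> the restriction
  is immaterial: the axiomatic range of \<open>rdf:type\<close> makes every \<open>y\<close> with
  \<open>(x, y) \<in> PT I (IV I rdf_type)\<close> a class.)
\<close>

definition erdf_interpretation ::
  "(string \<Rightarrow> bool) \<Rightarrow> 'u symbol set \<Rightarrow> ('u, 'e) einterp \<Rightarrow> bool" where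
  "erdf_interpretation wt V I \<longleftrightarrow>
     partial_interp I \<and> coherent I \<and> Voc I = V \<union> V_RDF \<union> V_RDFS \<union> V_ERDF \<and>
     Cls I \<subseteq> Res I \<and> TCls I \<subseteq> Cls I \<and> TProp I \<subseteq> Prop I \<and>
     CT I \<in> Cls I \<rightarrow> Pow (Res I) \<and> (\<forall>y. y \<notin> Cls I \<longrightarrow> CT I y = {}) \<and>
     CF I \<in> Cls I \<rightarrow> Pow (Res I) \<and> (\<forall>y. y \<notin> Cls I \<longrightarrow> CF I y = {}) \<and>
     (\<forall>y \<in> Cls I. \<forall>x. x \<in> CT I y \<longleftrightarrow> (x, y) \<in> PT I (IV I rdf_type)) \<and>
     (\<forall>y \<in> Cls I. \<forall>x. x \<in> CF I y \<longleftrightarrow> (x, y) \<in> PF I (IV I rdf_type)) \<and>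
     Prop I = CT I (IV I rdf_Property) \<and>
     Cls I = CT I (IV I rdfs_Class) \<and>
     Res I = CT I (IV I rdfs_Resource) \<and>
     LV I = CT I (IV I rdfs_Literal) \<and>
     TCls I = CT I (IV I erdf_TotalClass) \<and>
     TProp I = CT I (IV I erdf_TotalProperty) \<and>
     (\<forall>x y z w. (x, y) \<in> PT I (IV I rdfs_domain) \<and> (z, w) \<in> PT I x \<longrightarrow> z \<in> CT I y) \<and>
     (\<forall>x y z w. (x, y) \<in> PT I (IV I rdfs_range) \<and> (z, w) \<in> PT I x \<longrightarrow> w \<in> CT I y) \<and>
     (\<forall>x \<in> Cls I. (x, IV I rdfs_Resource) \<in> PT I (IV I rdfs_subClassOf)) \<and>
     (\<forall>x y. (x, y) \<in> PT I (IV I rdfs_subClassOf) \<longrightarrow>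
        x \<in> Cls I \<and> y \<in> Cls I \<and> CT I x \<subseteq> CT I y \<and> CF I y \<subseteq> CF I x) \<and>
     refl_on (Cls I) (PT I (IV I rdfs_subClassOf)) \<and>
     trans_on (Cls I) (PT I (IV I rdfs_subClassOf)) \<and>
     (\<forall>x y. (x, y) \<in> PT I (IV I rdfs_subPropertyOf) \<longrightarrow>
        x \<in> Prop I \<and> y \<in> Prop I \<and> PT I x \<subseteq> PT I y \<and> PF I y \<subseteq> PF I x) \<and>
     refl_on (Prop I) (PT I (IV I rdfs_subPropertyOf)) \<and>
     trans_on (Prop I) (PT I (IV I rdfs_subPropertyOf)) \<and>
     (\<forall>x \<in> CT I (IV I rdfs_Datatype).
        (x, IV I rdfs_Literal) \<in> PT I (IV I rdfs_subClassOf)) \<and>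
     (\<forall>x \<in> CT I (IV I rdfs_ContainerMembershipProperty).
        (x, IV I rdfs_member) \<in> PT I (IV I rdfs_subPropertyOf)) \<and>
     (\<forall>x \<in> TCls I. CT I x \<union> CF I x = Res I) \<and>
     (\<forall>x \<in> TProp I. PT I x \<union> PF I x = Res I \<times> Res I) \<and>
     (\<forall>s. TL (s, rdf_XMLLiteral) \<in> V \<and> wt s \<longrightarrow>
        IL I (s, rdf_XMLLiteral) = XMLVal s \<and>
        IL I (s, rdf_XMLLiteral) \<in> CT I (IV I rdf_XMLLiteral)) \<and>
     (\<forall>s. TL (s, rdf_XMLLiteral) \<in> V \<and> \<not> wt s \<longrightarrow>
        IL I (s, rdf_XMLLiteral) \<in> Res I - LV I \<and>
        IL I (s, rdf_XMLLiteral) \<in> CF I (IV I rdfs_Literal)) \<and>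
     (\<forall>t \<in> rdf_axioms \<union> rdfs_axioms \<union> erdf_axioms. models_form I (form_of t))"

section \<open>Herbrand interpretations and Herbrand models\<close>

definition wt_xml_lit :: "(string \<Rightarrow> bool) \<Rightarrow> 'u tlit \<Rightarrow> bool" where
  "wt_xml_lit wt l \<longleftrightarrow> snd l = rdf_XMLLiteral \<and> wt (fst l)"

definition herbrand_res ::
  "(string \<Rightarrow> bool) \<Rightarrow> ('x \<Rightarrow> 'u uri) \<Rightarrow> ('u, 'x) ontology \<Rightarrow> ('u, 'e) entity set" where
  "herbrand_res wt sk Ont =
     (Sy ` voc_ont sk Ont \<union> {XMLVal (fst l) | l. TL l \<in> voc_ont sk Ont \<and> wt_xml_lit wt l})
     - {Sy (TL l) | l. wt_xml_lit wt l}"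

definition herbrand_interps ::
  "(string \<Rightarrow> bool) \<Rightarrow> ('x \<Rightarrow> 'u uri) \<Rightarrow> ('u, 'x) ontology \<Rightarrow> ('u, 'e) einterp set" where
  "herbrand_interps wt sk Ont =
     {I. erdf_interpretation wt (voc_ont sk Ont) I \<and>
         Res I = herbrand_res wt sk Ont \<and>
         (\<forall>u. URI u \<in> voc_ont sk Ont \<longrightarrow> IV I u = Sy (URI u)) \<and>
         (\<forall>l. TL l \<in> voc_ont sk Ont \<longrightarrow>
            IL I l = (if wt_xml_lit wt l then XMLVal (fst l) else Sy (TL l)))}"

definition herbrand_models ::
  "(string \<Rightarrow> bool) \<Rightarrow> ('x \<Rightarrow> 'u uri) \<Rightarrow> ('u, 'x) ontology \<Rightarrow> ('u, 'e) einterp set" where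
  "herbrand_models wt sk Ont =
     {I \<in> herbrand_interps wt sk Ont. models_ontology I (skolemize sk (fst Ont), snd Ont)}"

definition interp_le :: "('u, 'e) einterp \<Rightarrow> ('u, 'e) einterp \<Rightarrow> bool" (infix "\<preceq>" 50) where
  "I \<preceq> J \<longleftrightarrow> Prop I \<subseteq> Prop J \<and> (\<forall>p \<in> Prop I. PT I p \<subseteq> PT J p \<and> PF I p \<subseteq> PF J p)"

definition minimal :: "('u, 'e) einterp set \<Rightarrow> ('u, 'e) einterp set" where
  "minimal S = {I \<in> S. \<not> (\<exists>J \<in> S. J \<noteq> I \<and> J \<preceq> I)}"

section \<open>Stable models\<close>

text \<open>The rules \<open>P\<^bsub>[I,M]\<^esub>\<close> that are applicable throughout the interval from \<open>I\<close> to \<open>M\<close>.\<close>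

definition interval_rules ::
  "(string \<Rightarrow> bool) \<Rightarrow> ('x \<Rightarrow> 'u uri) \<Rightarrow> ('u, 'x) ontology \<Rightarrow>
   ('u, 'e) einterp \<Rightarrow> ('u, 'e) einterp \<Rightarrow> ('u, 'x) program" where
  "interval_rules wt sk Ont I M =
     {r \<in> ground_program (voc_ont sk Ont) (snd Ont).
        \<forall>J \<in> herbrand_interps wt sk Ont. I \<preceq> J \<and> J \<preceq> M \<longrightarrow> models_body J (Cond r)}"

definition stable_models ::
  "(string \<Rightarrow> bool) \<Rightarrow> ('x \<Rightarrow> 'u uri) \<Rightarrow> ('u, 'x) ontology \<Rightarrow> ('u, 'e) einterp set" where
  "stable_models wt sk Ont =
     {M \<in> herbrand_interps wt sk Ont.
        \<exists>k (C :: nat \<Rightarrow> ('u, 'e) einterp).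
          (\<forall>\<alpha> \<le> k + 1. C \<alpha> \<in> herbrand_interps wt sk Ont) \<and>
          (\<forall>\<alpha> \<le> k. C \<alpha> \<preceq> C (\<alpha> + 1)) \<and>
          C k = M \<and> C (k + 1) = M \<and>
          C 0 \<in> minimal {I \<in> herbrand_interps wt sk Ont. models_graph I (skolemize sk (fst Ont))} \<and>
          (\<forall>\<alpha>. 0 < \<alpha> \<and> \<alpha> \<le> k + 1 \<longrightarrow>
             C \<alpha> \<in> minimal {I \<in> herbrand_interps wt sk Ont. C (\<alpha> - 1) \<preceq> I \<and>
                      (\<forall>r \<in> interval_rules wt sk Ont (C (\<alpha> - 1)) M. models_head I (Concl r))})}"

end

theory Submission
  imports Defs
begin

text \<open>
  The triple \<open>rdfs:subClassOf(rdf:Property, erdf:TotalProperty)\<close> makes every property of a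
  Herbrand interpretation \<open>I\<close> of the graph total, and coherence leaves no room to enlarge the
  extensions of a total property; so \<open>I \<preceq> J\<close> forces \<open>I = J\<close>. Hence the chain of a stable model
  \<open>M\<close> is constant, the interval from \<open>M\<close> to \<open>M\<close> is \<open>{M}\<close>, and stability says that \<open>M\<close> satisfies
  the graph and all ground instances of the rules. In a Herbrand interpretation every resource is
  denoted by a symbol, so the latter means that \<open>M\<close> satisfies the rules.
\<close>

section \<open>Substitution and satisfaction\<close>

lemma vars_trm_subst: "vars_trm (subst_trm \<theta> t) \<subseteq> vars_trm t"
  by (cases t) (auto split: option.splits)

lemma vars_trm_subst_None:
  "y \<in> vars_trm t \<Longrightarrow> \<theta> y = None \<Longrightarrow> y \<in> vars_trm (subst_trm \<theta> t)"
  by (cases t) auto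

lemma vars_subst: "vars (subst_form \<theta> F) \<subseteq> vars F"
proof (induction F arbitrary: \<theta>)
  case (Triple p s t)
  then show ?case using vars_trm_subst by fastforce
next
  case (Exi x F)
  then show ?case by fastforce
next
  case (Uni x F)
  then show ?case by fastforce
qed fastforce+

text \<open>Used at quantifiers: a valuation of the substituted formula is constrained only on the
  variables of that formula, so an unreplaced variable has to occur there still.\<close>

lemma vars_subst_None: "y \<in> vars F \<Longrightarrow> \<theta> y = None \<Longrightarrow> y \<in> vars (subst_form \<theta> F)"
  by (induction F arbitrary: \<theta>) (auto simp: vars_trm_subst_None)

text \<open>\<open>w\<close> is meant for the substituted formula and \<open>v\<close> for the
  original. Membership in \<open>Voc I\<close> is included because triples and weak negations test
  the symbols of a formula as well as their denotations.\<close>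

definition subst_matches ::
  "('u, 'e, 'z) pinterp_scheme \<Rightarrow> 'x set \<Rightarrow> ('x \<rightharpoonup> 'u symbol) \<Rightarrow>
   ('x \<Rightarrow> ('u, 'e) entity) \<Rightarrow> ('x \<Rightarrow> ('u, 'e) entity) \<Rightarrow> bool" where
  "subst_matches I X \<theta> w v \<longleftrightarrow>
     (\<forall>y \<in> X. case \<theta> y of None \<Rightarrow> w y = v y | Some c \<Rightarrow> c \<in> Voc I \<and> den I c = v y)"

lemma subst_matches_Un [simp]:
  "subst_matches I (X \<union> Y) \<theta> w v \<longleftrightarrow> subst_matches I X \<theta> w v \<and> subst_matches I Y \<theta> w v"
  by (auto simp: subst_matches_def)

lemma subst_matches_trm:
  assumes "subst_matches I (vars_trm t) \<theta> w v"
  shows "den_trm I w (subst_trm \<theta> t) = den_trm I v t"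
    and "syms_trm (subst_trm \<theta> t) \<subseteq> Voc I \<longleftrightarrow> syms_trm t \<subseteq> Voc I"
  using assms by (cases t; auto simp: subst_matches_def split: option.splits)+

text \<open>Serves the vocabulary test in the clause for \<open>WNeg\<close>. Substitution keeps all
  symbols and adds only symbols from \<open>V\<close>. Free variables suffice because binders are
  removed from \<theta>.\<close>

lemma syms_subst:
  assumes "\<forall>y \<in> fvars F. \<forall>c. \<theta> y = Some c \<longrightarrow> c \<in> V"
  shows "syms (subst_form \<theta> F) \<subseteq> V \<longleftrightarrow> syms F \<subseteq> V"
  using assms
proof (induction F arbitrary: \<theta>)
  case (Triple p s t)
  have "syms_trm (subst_trm \<theta> a) \<subseteq> V \<longleftrightarrow> syms_trm a \<subseteq> V" if "vars_trm a \<subseteq> vars_trm s \<union> vars_trm t" for a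
    using that Triple by (cases a) (auto split: option.splits)
  then show ?case by simp
next
  case (Exi x F)
  have "syms (subst_form (\<theta>(x := None)) F) \<subseteq> V \<longleftrightarrow> syms F \<subseteq> V"
    by (rule Exi.IH) (use Exi.prems in \<open>auto split: if_splits\<close>)
  then show ?case by simp
next
  case (Uni x F)
  have "syms (subst_form (\<theta>(x := None)) F) \<subseteq> V \<longleftrightarrow> syms F \<subseteq> V"
    by (rule Uni.IH) (use Uni.prems in \<open>auto split: if_splits\<close>)
  then show ?case by simp
qed (simp_all add: ball_Un)

text \<open>A valuation \<open>u\<close> ranged over by a quantifier on \<open>F\<close> gives one
  for the substituted body by copying only its value at \<open>x\<close> into \<open>w\<close>. At
  the other free variables \<open>u\<close> agrees with \<open>v\<close>, which already matches
  \<open>w\<close>.\<close>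

lemma quantifier_transfer_to:
  assumes w: "w \<in> insert x (vars (subst_form (\<theta>(x := None)) F)) \<rightarrow> Res I"
    and m: "subst_matches I (fvars F - {x}) \<theta> w v"
    and u: "u \<in> vars F \<rightarrow> Res I" "\<forall>y \<in> vars F - {x}. u y = v y"
    and fv: "fvars F \<subseteq> vars F"
  shows "w(x := u x) \<in> vars (subst_form (\<theta>(x := None)) F) \<rightarrow> Res I"
    and "subst_matches I (fvars F) (\<theta>(x := None)) (w(x := u x)) u"
proof -
  show "w(x := u x) \<in> vars (subst_form (\<theta>(x := None)) F) \<rightarrow> Res I"
    using w u(1) vars_subst[of "\<theta>(x := None)" F] by (auto simp: Pi_iff)
  show "subst_matches I (fvars F) (\<theta>(x := None)) (w(x := u x)) u"
    unfolding subst_matches_def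
  proof
    fix y assume y: "y \<in> fvars F"
    show "case (\<theta>(x := None)) y of None \<Rightarrow> (w(x := u x)) y = u y
        | Some c \<Rightarrow> c \<in> Voc I \<and> den I c = u y"
    proof (cases "y = x")
      case False
      have "case \<theta> y of None \<Rightarrow> w y = v y | Some c \<Rightarrow> c \<in> Voc I \<and> den I c = v y"
        using m y False unfolding subst_matches_def by blast
      moreover have "u y = v y" using False y u fv by auto
      ultimately show ?thesis using False by (auto split: option.splits)
    qed simp
  qed
qed

text \<open>In the opposite direction the value at \<open>x\<close> is copied into \<open>v\<close>.
  It lies in \<open>Res I\<close> whenever \<open>x\<close> occurs in \<open>F\<close>, since
  \<open>x\<close> is not replaced and so survives in the substituted body.\<close>

lemma quantifier_transfer_from:
  assumes v: "v \<in> insert x (vars F) \<rightarrow> Res I"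
    and m: "subst_matches I (fvars F - {x}) \<theta> w v"
    and u: "u \<in> vars (subst_form (\<theta>(x := None)) F) \<rightarrow> Res I"
      "\<forall>y \<in> vars (subst_form (\<theta>(x := None)) F) - {x}. u y = w y"
    and fv: "fvars F \<subseteq> vars F"
  shows "v(x := u x) \<in> vars F \<rightarrow> Res I"
    and "subst_matches I (fvars F) (\<theta>(x := None)) u (v(x := u x))"
proof -
  show "v(x := u x) \<in> vars F \<rightarrow> Res I"
    using v u(1) vars_subst_None[of x F "\<theta>(x := None)"] by (auto simp: Pi_iff)
  show "subst_matches I (fvars F) (\<theta>(x := None)) u (v(x := u x))"
    unfolding subst_matches_def
  proof
    fix y assume y: "y \<in> fvars F"
    show "case (\<theta>(x := None)) y of None \<Rightarrow> u y = (v(x := u x)) y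
        | Some c \<Rightarrow> c \<in> Voc I \<and> den I c = (v(x := u x)) y"
    proof (cases "y = x")
      case False
      have "case \<theta> y of None \<Rightarrow> w y = v y | Some c \<Rightarrow> c \<in> Voc I \<and> den I c = v y"
        using m y False unfolding subst_matches_def by blast
      moreover have "u y = w y" if "\<theta> y = None"
        using False y u fv vars_subst_None[of y F "\<theta>(x := None)"] that by auto
      ultimately show ?thesis using False by (auto split: option.splits)
    qed simp
  qed
qed

lemma fvars_subset_vars: "fvars F \<subseteq> vars F"
  by (induction F) auto

lemma rule_fvars_subset_rule_vars: "rule_fvars r \<subseteq> rule_vars r"
  unfolding rule_fvars_def rule_vars_def
  by (cases "Cond r") (auto dest: subsetD[OF fvars_subset_vars])

text \<open>\<open>F'\<close> is kept apart from \<open>F\<close> so that it can be \<open>F\<close>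
  or \<open>SNeg F\<close>, which have the same variables: strong negation crosses a quantifier by
  turning it into the dual one.\<close>

lemma sat_quantifier_subst:
  assumes w: "w \<in> vars (subst_form \<theta> (Exi x F)) \<rightarrow> Res I"
    and v: "v \<in> vars (Exi x F) \<rightarrow> Res I"
    and m: "subst_matches I (fvars (Exi x F)) \<theta> w v"
    and IH: "\<And>u u'. u' \<in> vars (subst_form (\<theta>(x := None)) F) \<rightarrow> Res I \<Longrightarrow> u \<in> vars F \<rightarrow> Res I \<Longrightarrow>
        subst_matches I (fvars F) (\<theta>(x := None)) u' u \<Longrightarrow>
        sat I u' (subst_form (\<theta>(x := None)) F') \<longleftrightarrow> sat I u F'"
    and F': "vars F' = vars F" "vars (subst_form (\<theta>(x := None)) F') = vars (subst_form (\<theta>(x := None)) F)"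
  shows "sat I w (subst_form \<theta> (Exi x F')) \<longleftrightarrow> sat I v (Exi x F')"
    and "sat I w (subst_form \<theta> (Uni x F')) \<longleftrightarrow> sat I v (Uni x F')"
proof -
  let ?G = "subst_form (\<theta>(x := None)) F"
  let ?U = "{u \<in> vars F \<rightarrow> Res I. \<forall>y \<in> vars F - {x}. u y = v y}"
  let ?W = "{u \<in> vars ?G \<rightarrow> Res I. \<forall>y \<in> vars ?G - {x}. u y = w y}"
  let ?G' = "subst_form (\<theta>(x := None)) F'"
  have m': "subst_matches I (fvars F - {x}) \<theta> w v" using m by simp
  have w': "w \<in> insert x (vars ?G) \<rightarrow> Res I" using w by simp
  have v': "v \<in> insert x (vars F) \<rightarrow> Res I" using v by simp
  \<comment> \<open>Together with \<open>bwd\<close>, this pairs each valuation on one side with one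
    of equal truth value on the other, which transfers both quantifiers at once.\<close>
  have fwd: "\<exists>u' \<in> ?W. sat I u' ?G' \<longleftrightarrow> sat I u F'" if "u \<in> ?U" for u
  proof -
    have u: "u \<in> vars F \<rightarrow> Res I" "\<forall>y \<in> vars F - {x}. u y = v y" using that by auto
    note q = quantifier_transfer_to[OF w' m' u fvars_subset_vars]
    have "sat I (w(x := u x)) ?G' \<longleftrightarrow> sat I u F'"
      by (rule IH[OF q(1) u(1) q(2)])
    moreover have "w(x := u x) \<in> ?W" using q(1) by simp
    ultimately show ?thesis by blast
  qed
  have bwd: "\<exists>u' \<in> ?U. sat I u ?G' \<longleftrightarrow> sat I u' F'" if "u \<in> ?W" for u
  proof -
    have u: "u \<in> vars ?G \<rightarrow> Res I" "\<forall>y \<in> vars ?G - {x}. u y = w y" using that by auto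
    note q = quantifier_transfer_from[OF v' m' u fvars_subset_vars]
    have "sat I u ?G' \<longleftrightarrow> sat I (v(x := u x)) F'"
      by (rule IH[OF u(1) q(1) q(2)])
    moreover have "v(x := u x) \<in> ?U" using q(1) by simp
    ultimately show ?thesis by blast
  qed
  have e1: "sat I w (subst_form \<theta> (Exi x F')) \<longleftrightarrow> (\<exists>u \<in> ?W. sat I u ?G')"
    "sat I v (Exi x F') \<longleftrightarrow> (\<exists>u \<in> ?U. sat I u F')"
    "sat I w (subst_form \<theta> (Uni x F')) \<longleftrightarrow> (\<forall>u \<in> ?W. sat I u ?G')"
    "sat I v (Uni x F') \<longleftrightarrow> (\<forall>u \<in> ?U. sat I u F')"
    by (auto simp: F')
  show "sat I w (subst_form \<theta> (Exi x F')) \<longleftrightarrow> sat I v (Exi x F')"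
    and "sat I w (subst_form \<theta> (Uni x F')) \<longleftrightarrow> sat I v (Uni x F')"
    unfolding e1 using fwd bwd by blast+
qed

text \<open>Satisfaction pushes strong negation inwards, so the induction needs both polarities.\<close>

lemma sat_subst:
  assumes "w \<in> vars (subst_form \<theta> F) \<rightarrow> Res I"
    and "v \<in> vars F \<rightarrow> Res I"
    and "subst_matches I (fvars F) \<theta> w v"
  shows "(sat I w (subst_form \<theta> F) \<longleftrightarrow> sat I v F) \<and>
    (sat I w (subst_form \<theta> (SNeg F)) \<longleftrightarrow> sat I v (SNeg F))"
  using assms
proof (induction F arbitrary: \<theta> w v)
  case (Triple p s t)
  then have m: "subst_matches I (vars_trm s) \<theta> w v" "subst_matches I (vars_trm t) \<theta> w v"
    by simp_all
  show ?case by (simp add: m[THEN subst_matches_trm(1)] m[THEN subst_matches_trm(2)])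
next
  case (WNeg F)
  have "syms (subst_form \<theta> F) \<subseteq> Voc I \<longleftrightarrow> syms F \<subseteq> Voc I"
    by (rule syms_subst) (use WNeg.prems(3) in \<open>force simp: subst_matches_def\<close>)
  moreover have "sat I w (subst_form \<theta> F) \<longleftrightarrow> sat I v F"
    using WNeg by simp
  ultimately show ?case by simp
next
  case (SNeg F)
  then show ?case by simp
next
  case (Conj F G)
  then have "w \<in> vars (subst_form \<theta> F) \<rightarrow> Res I" "w \<in> vars (subst_form \<theta> G) \<rightarrow> Res I"
    "v \<in> vars F \<rightarrow> Res I" "v \<in> vars G \<rightarrow> Res I"
    by auto
  with Conj show ?case by simp
next
  case (Disj F G)
  then have "w \<in> vars (subst_form \<theta> F) \<rightarrow> Res I" "w \<in> vars (subst_form \<theta> G) \<rightarrow> Res I"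
    "v \<in> vars F \<rightarrow> Res I" "v \<in> vars G \<rightarrow> Res I"
    by auto
  with Disj show ?case by simp
next
  case (Impl F G)
  \<comment> \<open>Implication unfolds to a disjunction containing \<open>WNeg F\<close>, so the
    vocabulary test on \<open>F\<close> reappears here.\<close>
  have "syms (subst_form \<theta> F) \<subseteq> Voc I \<longleftrightarrow> syms F \<subseteq> Voc I"
    by (rule syms_subst) (use Impl.prems(3) in \<open>force simp: subst_matches_def\<close>)
  moreover have "w \<in> vars (subst_form \<theta> F) \<rightarrow> Res I" "w \<in> vars (subst_form \<theta> G) \<rightarrow> Res I"
    "v \<in> vars F \<rightarrow> Res I" "v \<in> vars G \<rightarrow> Res I"
    using Impl.prems by auto
  ultimately show ?case using Impl by simp
next
  case (Exi x F)
  note Q = sat_quantifier_subst[OF Exi.prems]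
  have "sat I w (subst_form \<theta> (Exi x F)) \<longleftrightarrow> sat I v (Exi x F)"
    by (rule Q(1)[OF Exi.IH[THEN conjunct1] refl refl])
  \<comment> \<open>\<open>SNeg (Exi x F)\<close> is evaluated as this universal formula; the
    negative half of the induction hypothesis handles its body.\<close>
  moreover have "sat I w (subst_form \<theta> (Uni x (SNeg F))) \<longleftrightarrow> sat I v (Uni x (SNeg F))"
  proof (rule Q(2))
    fix u u' assume "u' \<in> vars (subst_form (\<theta>(x := None)) F) \<rightarrow> Res I" "u \<in> vars F \<rightarrow> Res I"
      "subst_matches I (fvars F) (\<theta>(x := None)) u' u"
    then show "sat I u' (subst_form (\<theta>(x := None)) (SNeg F)) \<longleftrightarrow> sat I u (SNeg F)"
      using Exi.IH by blast
  qed simp_all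
  ultimately show ?case by simp
next
  case (Uni x F)
  \<comment> \<open>The quantifier lemma is phrased with \<open>Exi\<close>; \<open>vars\<close> and
    \<open>fvars\<close> do not distinguish the two quantifiers.\<close>
  have pr: "w \<in> vars (subst_form \<theta> (Exi x F)) \<rightarrow> Res I" "v \<in> vars (Exi x F) \<rightarrow> Res I"
    "subst_matches I (fvars (Exi x F)) \<theta> w v"
    using Uni.prems by simp_all
  note Q = sat_quantifier_subst[OF pr]
  have "sat I w (subst_form \<theta> (Uni x F)) \<longleftrightarrow> sat I v (Uni x F)"
    by (rule Q(2)[OF Uni.IH[THEN conjunct1] refl refl])
  moreover have "sat I w (subst_form \<theta> (Exi x (SNeg F))) \<longleftrightarrow> sat I v (Exi x (SNeg F))"
  proof (rule Q(1))
    fix u u' assume "u' \<in> vars (subst_form (\<theta>(x := None)) F) \<rightarrow> Res I" "u \<in> vars F \<rightarrow> Res I"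
      "subst_matches I (fvars F) (\<theta>(x := None)) u' u"
    then show "sat I u' (subst_form (\<theta>(x := None)) (SNeg F)) \<longleftrightarrow> sat I u (SNeg F)"
      using Uni.IH by blast
  qed simp_all
  ultimately show ?case by simp
qed

text \<open>\<theta> replaces every free variable, so the match holds for any \<open>w\<close> and
  all valuations of the substituted formula give the same truth value.\<close>

lemma models_form_subst:
  assumes v: "v \<in> vars F \<rightarrow> Res I"
    and \<theta>: "\<And>y. y \<in> fvars F \<Longrightarrow> \<exists>c \<in> Voc I. \<theta> y = Some c \<and> den I c = v y"
  shows "models_form I (subst_form \<theta> F) \<longleftrightarrow> sat I v F"
proof -
  have m: "subst_matches I (fvars F) \<theta> w v" for w
    using \<theta> by (force simp: subst_matches_def)
  have "sat I w (subst_form \<theta> F) \<longleftrightarrow> sat I v F" if "w \<in> vars (subst_form \<theta> F) \<rightarrow> Res I" for w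
    using sat_subst[OF that v m] by simp
  \<comment> \<open>\<open>v\<close> itself is admissible for the substituted formula, so the
    universal quantifier in \<open>models_form\<close> is not vacuous.\<close>
  moreover have "v \<in> vars (subst_form \<theta> F) \<rightarrow> Res I"
    using v vars_subst[of \<theta> F] by auto
  ultimately show ?thesis unfolding models_form_def by blast
qed

section \<open>Ground instances of rules\<close>

lemma form_of_subst_triple: "form_of (subst_triple \<theta> t) = subst_form \<theta> (form_of t)"
  by (cases t) auto

lemma fvars_form_of: "fvars (form_of t) = vars (form_of t)"
  by (cases t) auto

lemma ground_instance_iff:
  assumes v: "v \<in> rule_vars r \<rightarrow> Res I"
    and \<theta>: "\<And>y. y \<in> rule_fvars r \<Longrightarrow> \<exists>c \<in> Voc I. \<theta> y = Some c \<and> den I c = v y"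
  shows "models_body I (subst_body \<theta> (Cond r)) \<longleftrightarrow> sat_body I v (Cond r)"
    and "models_head I (subst_head \<theta> (Concl r)) \<longleftrightarrow> sat_head I v (Concl r)"
proof -
  show "models_body I (subst_body \<theta> (Cond r)) \<longleftrightarrow> sat_body I v (Cond r)"
  proof (cases "Cond r")
    case (BForm F)
    have "models_form I (subst_form \<theta> F) \<longleftrightarrow> sat I v F"
      by (rule models_form_subst)
        (use v \<theta> BForm in \<open>auto simp: rule_vars_def rule_fvars_def\<close>)
    then show ?thesis using BForm by simp
  qed simp
  show "models_head I (subst_head \<theta> (Concl r)) \<longleftrightarrow> sat_head I v (Concl r)"
  proof (cases "Concl r")
    case (HTriple t)
    have "models_form I (subst_form \<theta> (form_of t)) \<longleftrightarrow> sat I v (form_of t)"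
      by (rule models_form_subst)
        (use v \<theta> HTriple in \<open>auto simp: rule_vars_def rule_fvars_def fvars_form_of\<close>)
    then show ?thesis using HTriple by (simp add: form_of_subst_triple)
  qed simp
qed

section \<open>Herbrand interpretations\<close>

lemma partial_interpD:
  assumes "partial_interp I"
  shows "IV I \<in> {u. URI u \<in> Voc I} \<rightarrow>\<^sub>E Res I \<union> Prop I"
    and "IL I \<in> {l. TL l \<in> Voc I} \<rightarrow>\<^sub>E Res I"
    and "PT I \<in> Prop I \<rightarrow> Pow (Res I \<times> Res I)" and "\<forall>x. x \<notin> Prop I \<longrightarrow> PT I x = {}"
    and "PF I \<in> Prop I \<rightarrow> Pow (Res I \<times> Res I)" and "\<forall>x. x \<notin> Prop I \<longrightarrow> PF I x = {}"
  by (insert assms[unfolded partial_interp_def], elim conjE, assumption)+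

lemma erdf_interpretationD:
  assumes "erdf_interpretation wt V I"
  shows "partial_interp I" and "coherent I"
    and "\<forall>y. y \<notin> Cls I \<longrightarrow> CT I y = {}" and "\<forall>y. y \<notin> Cls I \<longrightarrow> CF I y = {}"
    and "\<forall>y \<in> Cls I. \<forall>x. x \<in> CT I y \<longleftrightarrow> (x, y) \<in> PT I (IV I rdf_type)"
    and "\<forall>y \<in> Cls I. \<forall>x. x \<in> CF I y \<longleftrightarrow> (x, y) \<in> PF I (IV I rdf_type)"
    and "Prop I = CT I (IV I rdf_Property)"
    and "Cls I = CT I (IV I rdfs_Class)"
    and "LV I = CT I (IV I rdfs_Literal)"
    and "TCls I = CT I (IV I erdf_TotalClass)"
    and "TProp I = CT I (IV I erdf_TotalProperty)"
    and "\<forall>x y. (x, y) \<in> PT I (IV I rdfs_subClassOf) \<longrightarrow>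
        x \<in> Cls I \<and> y \<in> Cls I \<and> CT I x \<subseteq> CT I y \<and> CF I y \<subseteq> CF I x"
    and "\<forall>x \<in> TProp I. PT I x \<union> PF I x = Res I \<times> Res I"
    and "\<forall>t \<in> rdf_axioms \<union> rdfs_axioms \<union> erdf_axioms. models_form I (form_of t)"
  by (insert assms[unfolded erdf_interpretation_def], elim conjE, assumption)+

lemma herbrand_Voc:
  assumes "I \<in> herbrand_interps wt sk Ont"
  shows "Voc I = voc_ont sk Ont"
  using assms by (auto simp: herbrand_interps_def erdf_interpretation_def voc_ont_def)

text \<open>Symbols of the vocabulary denote themselves, except that well-typed XML literals denote
  their XML values; \<open>herbrand_res\<close> makes exactly this exchange. Hence every resource
  has a name.\<close>

lemma herbrand_Res_eq_den:
  assumes I: "I \<in> herbrand_interps wt sk Ont"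
  shows "Res I = den I ` voc_ont sk Ont"
proof -
  let ?V = "voc_ont sk Ont"
  have R: "Res I = herbrand_res wt sk Ont"
    and U: "\<And>u. URI u \<in> ?V \<Longrightarrow> IV I u = Sy (URI u)"
    and L: "\<And>l. TL l \<in> ?V \<Longrightarrow> IL I l = (if wt_xml_lit wt l then XMLVal (fst l) else Sy (TL l))"
    using I by (auto simp: herbrand_interps_def)
  have D: "den I c = (case c of TL l \<Rightarrow> if wt_xml_lit wt l then XMLVal (fst l) else Sy c | _ \<Rightarrow> Sy c)"
    if "c \<in> ?V" for c
    using that U L by (cases c) auto
  show ?thesis
  proof
    show "Res I \<subseteq> den I ` ?V"
    proof
      fix e assume "e \<in> Res I"
      then consider c where "c \<in> ?V" "e = Sy c" "\<forall>l. c = TL l \<longrightarrow> \<not> wt_xml_lit wt l"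
        | l where "TL l \<in> ?V" "wt_xml_lit wt l" "e = XMLVal (fst l)"
        unfolding R herbrand_res_def by auto
      then show "e \<in> den I ` ?V"
      proof cases
        case 1
        then have "den I c = e" using D by (auto split: symbol.splits)
        then show ?thesis using 1 by blast
      next
        case 2
        then have "den I (TL l) = e" using L by simp
        then show ?thesis using 2 by blast
      qed
    qed
    show "den I ` ?V \<subseteq> Res I"
      unfolding R herbrand_res_def by (auto simp: D split: symbol.splits if_splits)
  qed
qed

text \<open>Since every resource has a name, valuations of the free variables in
  \<open>Res I\<close> and groundings over the vocabulary cover each other.\<close>

lemma herbrand_models_rule_iff:
  assumes I: "I \<in> herbrand_interps wt sk Ont"
  shows "models_rule I r \<longleftrightarrow>
    (\<forall>r' \<in> ground_rule (voc_ont sk Ont) r. models_body I (Cond r') \<longrightarrow> models_head I (Concl r'))"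
proof
  note Voc = herbrand_Voc[OF I] and Res = herbrand_Res_eq_den[OF I]
  {
    assume r: "models_rule I r"
    show "\<forall>r' \<in> ground_rule (voc_ont sk Ont) r. models_body I (Cond r') \<longrightarrow> models_head I (Concl r')"
    proof
      fix r' assume "r' \<in> ground_rule (voc_ont sk Ont) r"
      then obtain \<theta> where r': "r' = Rule (subst_head \<theta> (Concl r)) (subst_body \<theta> (Cond r))"
        and \<theta>: "dom \<theta> = rule_fvars r" "ran \<theta> \<subseteq> voc_ont sk Ont"
        unfolding ground_rule_def by auto
      \<comment> \<open>Bound variables of the rule lie outside the domain of \<theta> but still
        need a value in \<open>Res I\<close>; \<open>rdf_type\<close> is a symbol present in every
        vocabulary.\<close>
      define v where "v y = den I (case \<theta> y of Some c \<Rightarrow> c | None \<Rightarrow> URI rdf_type)" for y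
      have "URI rdf_type \<in> voc_ont sk Ont" by (auto simp: voc_ont_def V_RDF_def)
      then have "(case \<theta> y of Some c \<Rightarrow> c | None \<Rightarrow> URI rdf_type) \<in> voc_ont sk Ont" for y
        using ranI[of \<theta> y] \<theta>(2) by (cases "\<theta> y") auto
      then have v: "v \<in> rule_vars r \<rightarrow> Res I"
        unfolding Res v_def by blast
      have m: "\<exists>c \<in> Voc I. \<theta> y = Some c \<and> den I c = v y" if y: "y \<in> rule_fvars r" for y
      proof -
        obtain c where c: "\<theta> y = Some c" using y \<theta>(1) domD[of y \<theta>] by auto
        then have "c \<in> Voc I" unfolding Voc by (rule subsetD[OF \<theta>(2) ranI])
        then show ?thesis using c by (simp add: v_def)
      qed
      show "models_body I (Cond r') \<longrightarrow> models_head I (Concl r')"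
        using r v ground_instance_iff[OF v m] by (simp add: r' models_rule_def)
    qed
  }
  assume g: "\<forall>r' \<in> ground_rule (voc_ont sk Ont) r. models_body I (Cond r') \<longrightarrow> models_head I (Concl r')"
  show "models_rule I r"
    unfolding models_rule_def
  proof
    fix v assume v: "v \<in> rule_vars r \<rightarrow> Res I"
    have "\<exists>c \<in> voc_ont sk Ont. den I c = v y" if "y \<in> rule_fvars r" for y
    proof -
      have "v y \<in> Res I"
        using funcset_mem[OF v subsetD[OF rule_fvars_subset_rule_vars that]] .
      then show ?thesis unfolding Res by auto
    qed
    \<comment> \<open>\<open>f\<close> chooses a name for the value of each free variable.\<close>
    then obtain f where f: "\<And>y. y \<in> rule_fvars r \<Longrightarrow> f y \<in> voc_ont sk Ont \<and> den I (f y) = v y"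
      by metis
    \<comment> \<open>The restriction to free variables gives \<theta> the exact domain that
      \<open>ground_rule\<close> demands.\<close>
    define \<theta> where "\<theta> y = (if y \<in> rule_fvars r then Some (f y) else None)" for y
    have m: "\<exists>c \<in> Voc I. \<theta> y = Some c \<and> den I c = v y" if "y \<in> rule_fvars r" for y
      using that f Voc by (auto simp: \<theta>_def)
    have "dom \<theta> = rule_fvars r" "ran \<theta> \<subseteq> voc_ont sk Ont"
      using f by (auto simp: \<theta>_def dom_def ran_def split: if_splits)
    then have "Rule (subst_head \<theta> (Concl r)) (subst_body \<theta> (Cond r)) \<in> ground_rule (voc_ont sk Ont) r"
      unfolding ground_rule_def by blast
    then show "sat_body I v (Cond r) \<longrightarrow> sat_head I v (Concl r)"
      using g ground_instance_iff[OF v m] by (metis rule.sel)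
  qed
qed

section \<open>Rigidity of total Herbrand interpretations\<close>

lemma interp_le_refl: "I \<preceq> I"
  by (simp add: interp_le_def)

lemma herbrand_IV:
  assumes "I \<in> herbrand_interps wt sk Ont" "URI u \<in> V_RDF \<union> V_RDFS \<union> V_ERDF"
  shows "IV I u = Sy (URI u)"
proof -
  have "URI u \<in> voc_ont sk Ont" unfolding voc_ont_def by (rule subsetD[OF _ assms(2)]) auto
  then show ?thesis using assms(1) by (simp add: herbrand_interps_def)
qed

text \<open>Properties and classes are class extensions, and these are read off
  \<open>rdf:type\<close>. As \<open>CT\<close> is tied to \<open>rdf:type\<close> only on
  \<open>Cls I\<close>, it has to be shown first that \<open>rdf:Property\<close> and
  \<open>rdfs:Class\<close> are classes.\<close>

lemma herbrand_determined_by_PT_PF: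
  assumes I: "I \<in> herbrand_interps wt sk Ont"
  shows "Sy (URI rdf_type) \<in> Prop I"
    and "Prop I = {x. (x, Sy (URI rdf_Property)) \<in> PT I (Sy (URI rdf_type))}"
    and "Cls I = {x. (x, Sy (URI rdfs_Class)) \<in> PT I (Sy (URI rdf_type))}"
    and "CT I = (\<lambda>y. if y \<in> Cls I then {x. (x, y) \<in> PT I (Sy (URI rdf_type))} else {})"
    and "CF I = (\<lambda>y. if y \<in> Cls I then {x. (x, y) \<in> PF I (Sy (URI rdf_type))} else {})"
proof -
  have E: "erdf_interpretation wt (voc_ont sk Ont) I"
    using I by (simp add: herbrand_interps_def)
  note iv = herbrand_IV[OF I]
  have iv': "IV I rdf_type = Sy (URI rdf_type)" "IV I rdf_Property = Sy (URI rdf_Property)"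
    "IV I rdfs_Class = Sy (URI rdfs_Class)"
    by (rule iv; unfold V_RDF_def V_RDFS_def; blast)+
  \<comment> \<open>Satisfaction of a triple includes that its predicate denotes a property.\<close>
  have "gtriple rdf_type rdf_type rdf_Property \<in> rdf_axioms"
    unfolding rdf_axioms_def by blast
  then have "models_form I (form_of (gtriple rdf_type rdf_type rdf_Property))"
    using erdf_interpretationD(14)[OF E] by blast
  then show tp: "Sy (URI rdf_type) \<in> Prop I"
    by (auto simp: models_form_def iv')
  have ct: "CT I y = (if y \<in> Cls I then {x. (x, y) \<in> PT I (Sy (URI rdf_type))} else {})" for y
  proof (cases "y \<in> Cls I")
    case True
    show ?thesis
      using bspec[OF erdf_interpretationD(5)[OF E] True] unfolding iv' by (simp add: True set_eq_iff)
  next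
    case False
    then show ?thesis using erdf_interpretationD(3)[OF E] by simp
  qed
  have cf: "CF I y = (if y \<in> Cls I then {x. (x, y) \<in> PF I (Sy (URI rdf_type))} else {})" for y
  proof (cases "y \<in> Cls I")
    case True
    show ?thesis
      using bspec[OF erdf_interpretationD(6)[OF E] True] unfolding iv' by (simp add: True set_eq_iff)
  next
    case False
    then show ?thesis using erdf_interpretationD(4)[OF E] by simp
  qed
  show "CT I = (\<lambda>y. if y \<in> Cls I then {x. (x, y) \<in> PT I (Sy (URI rdf_type))} else {})"
    and "CF I = (\<lambda>y. if y \<in> Cls I then {x. (x, y) \<in> PF I (Sy (URI rdf_type))} else {})"
    by (rule ext, rule ct, rule ext, rule cf)
  have pc: "Prop I = CT I (Sy (URI rdf_Property))" "Cls I = CT I (Sy (URI rdfs_Class))"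
    using erdf_interpretationD(7,8)[OF E] unfolding iv' .
  \<comment> \<open>\<open>CT\<close> is empty off \<open>Cls I\<close>, so anything with an
    instance is a class. This applies to \<open>rdf:Property\<close>, with instance
    \<open>rdf:type\<close>, and then to \<open>rdfs:Class\<close>, with instance
    \<open>rdf:Property\<close>.\<close>
  have nonempty: "y \<in> Cls I" if "x \<in> CT I y" for x y
    using that erdf_interpretationD(3)[OF E] by auto
  have ct_Cls: "CT I y = {x. (x, y) \<in> PT I (Sy (URI rdf_type))}" if "y \<in> Cls I" for y
    using ct[of y] that by simp
  have Property: "Sy (URI rdf_Property) \<in> Cls I"
    by (rule nonempty[OF tp[unfolded pc(1)]])
  show "Prop I = {x. (x, Sy (URI rdf_Property)) \<in> PT I (Sy (URI rdf_type))}"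
    unfolding pc(1) by (rule ct_Cls[OF Property])
  have "Sy (URI rdf_Property) \<in> CT I (Sy (URI rdfs_Class))"
    using Property by (simp only: pc(2)[symmetric])
  then have "Sy (URI rdfs_Class) \<in> Cls I"
    by (rule nonempty)
  from ct_Cls[OF this] show "Cls I = {x. (x, Sy (URI rdfs_Class)) \<in> PT I (Sy (URI rdf_type))}"
    by (simp only: pc(2)[symmetric])
qed

text \<open>The ontology fixes vocabulary, resources and denotations; the remaining components are
  class extensions, hence determined by \<open>PT\<close> and \<open>PF\<close>.\<close>

lemma herbrand_eqI:
  assumes I: "I \<in> herbrand_interps wt sk Ont" and J: "J \<in> herbrand_interps wt sk Ont"
    and PT: "PT I = PT J" and PF: "PF I = PF J"
  shows "I = J"
proof -
  note bI = herbrand_determined_by_PT_PF[OF I] and bJ = herbrand_determined_by_PT_PF[OF J]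
  have Prop: "Prop I = Prop J" by (simp only: bI(2) bJ(2) PT)
  have Cls: "Cls I = Cls J" by (simp only: bI(3) bJ(3) PT)
  have CT: "CT I = CT J" by (simp only: bI(4) bJ(4) PT Cls)
  have CF: "CF I = CF J" by (simp only: bI(5) bJ(5) PF Cls)
  have Voc: "Voc I = Voc J" using herbrand_Voc[OF I] herbrand_Voc[OF J] by simp
  have EI: "erdf_interpretation wt (voc_ont sk Ont) I" and EJ: "erdf_interpretation wt (voc_ont sk Ont) J"
    using I J by (simp_all add: herbrand_interps_def)
  have Res: "Res I = Res J" using I J by (simp add: herbrand_interps_def)
  have pI: "partial_interp I" and pJ: "partial_interp J"
    using EI EJ by (auto dest: erdf_interpretationD(1,2))
  \<comment> \<open>Agreement on the vocabulary is enough because both maps are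
    \<open>undefined\<close> elsewhere.\<close>
  have IV: "IV I = IV J"
  proof (rule PiE_ext)
    show "IV I \<in> {u. URI u \<in> Voc I} \<rightarrow>\<^sub>E Res I \<union> Prop I" "IV J \<in> {u. URI u \<in> Voc I} \<rightarrow>\<^sub>E Res I \<union> Prop I"
      using partial_interpD(1)[OF pI] partial_interpD(1)[OF pJ] by (simp_all only: Voc Res Prop)
    show "IV I u = IV J u" if "u \<in> {u. URI u \<in> Voc I}" for u
      using that I J herbrand_Voc[OF I] by (simp add: herbrand_interps_def)
  qed
  have IL: "IL I = IL J"
  proof (rule PiE_ext)
    show "IL I \<in> {l. TL l \<in> Voc I} \<rightarrow>\<^sub>E Res I" "IL J \<in> {l. TL l \<in> Voc I} \<rightarrow>\<^sub>E Res I"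
      using partial_interpD(2)[OF pI] partial_interpD(2)[OF pJ] by (simp_all only: Voc Res)
    show "IL I l = IL J l" if "l \<in> {l. TL l \<in> Voc I}" for l
      using that I J herbrand_Voc[OF I] by (cases l) (simp add: herbrand_interps_def)
  qed
  have "LV I = LV J" "TCls I = TCls J" "TProp I = TProp J"
    using CT IV erdf_interpretationD(9-11)[OF EI] erdf_interpretationD(9-11)[OF EJ] by simp_all
  then show ?thesis
    using Prop Cls CT CF Voc Res IV IL PT PF by (cases I; cases J) simp
qed

text \<open>The extensions of \<open>p\<close> in \<open>I\<close> already cover all pairs. Those in
  \<open>J\<close> contain them and are disjoint, so neither can gain a pair.\<close>

lemma total_herbrand_le_imp_eq:
  assumes I: "I \<in> herbrand_interps wt sk Ont" and J: "J \<in> herbrand_interps wt sk Ont"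
    and total: "\<And>p. p \<in> Prop I \<Longrightarrow> PT I p \<union> PF I p = Res I \<times> Res I"
    and le: "I \<preceq> J"
  shows "I = J"
proof -
  have Res: "Res I = Res J" using I J by (simp add: herbrand_interps_def)
  have EI: "erdf_interpretation wt (voc_ont sk Ont) I" and EJ: "erdf_interpretation wt (voc_ont sk Ont) J"
    using I J by (simp_all add: herbrand_interps_def)
  have pI: "partial_interp I" and pJ: "partial_interp J" and cJ: "coherent J"
    using EI EJ by (auto dest: erdf_interpretationD(1,2))
  have eq: "PT I p = PT J p \<and> PF I p = PF J p" if p: "p \<in> Prop I" for p
  proof -
    have pJ': "p \<in> Prop J" and sub: "PT I p \<subseteq> PT J p" "PF I p \<subseteq> PF J p"
      using le p by (auto simp: interp_le_def)
    have "PT J p \<inter> PF J p = {}" using cJ pJ' by (simp add: coherent_def)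
    moreover have "PT J p \<subseteq> Res I \<times> Res I" "PF J p \<subseteq> Res I \<times> Res I"
      using funcset_mem[OF partial_interpD(3)[OF pJ] pJ'] funcset_mem[OF partial_interpD(5)[OF pJ] pJ']
      by (simp_all add: Res)
    ultimately show ?thesis using sub total[OF p] by blast
  qed
  note bI = herbrand_determined_by_PT_PF[OF I] and bJ = herbrand_determined_by_PT_PF[OF J]
  \<comment> \<open>The order allows \<open>J\<close> to have further properties, but each would be
    a new \<open>rdf:type\<close> pair, and \<open>rdf:type\<close> is a property of
    \<open>I\<close> whose extension is already fixed.\<close>
  have Prop: "Prop I = Prop J"
    using eq[OF bI(1)] by (simp only: bI(2) bJ(2))
  have "PT I p = PT J p" "PF I p = PF J p" for p
    using eq[of p] Prop partial_interpD(4,6)[OF pI] partial_interpD(4,6)[OF pJ]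
    by (cases "p \<in> Prop I"; simp)+
  then show ?thesis by (intro herbrand_eqI[OF I J] ext)
qed

text \<open>The subclass triple yields \<open>Prop I\<close> \<subseteq> \<open>TProp I\<close>, and
  total properties cover all pairs.\<close>

lemma herbrand_properties_total:
  assumes I: "I \<in> herbrand_interps wt sk Ont"
    and triple: "Pos rdfs_subClassOf (Sym (URI rdf_Property)) (Sym (URI erdf_TotalProperty)) \<in> G"
    and mod: "models_graph I (skolemize sk G)"
    and p: "p \<in> Prop I"
  shows "PT I p \<union> PF I p = Res I \<times> Res I"
proof -
  have E: "erdf_interpretation wt (voc_ont sk Ont) I"
    using I by (simp add: herbrand_interps_def)
  \<comment> \<open>The triple is ground, so skolemization leaves it unchanged.\<close>
  have "Pos rdfs_subClassOf (Sym (URI rdf_Property)) (Sym (URI erdf_TotalProperty)) \<in> skolemize sk G"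
    unfolding skolemize_def by (rule image_eqI[OF _ triple]) simp
  then have "(IV I rdf_Property, IV I erdf_TotalProperty) \<in> PT I (IV I rdfs_subClassOf)"
    using mod unfolding models_graph_def by force
  then have "CT I (IV I rdf_Property) \<subseteq> CT I (IV I erdf_TotalProperty)"
    using erdf_interpretationD(12)[OF E] by blast
  moreover have "Prop I = CT I (IV I rdf_Property)" "TProp I = CT I (IV I erdf_TotalProperty)"
    using erdf_interpretationD(7,11)[OF E] by blast+
  ultimately have "p \<in> TProp I" using p by blast
  then show ?thesis using erdf_interpretationD(13)[OF E] by blast
qed

section \<open>Stable models and Herbrand models coincide\<close>

theorem proposition5p2:
  fixes wt :: "string \<Rightarrow> bool"
    and sk :: "'x \<Rightarrow> 'u uri"
    and G :: "('u, 'x) graph"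
    and P :: "('u, 'x) program"
  assumes "erdf_ontology (G, P)"
    and "skolemization sk (G, P)"
    and "Pos rdfs_subClassOf (Sym (URI rdf_Property)) (Sym (URI erdf_TotalProperty)) \<in> G"
  shows "(stable_models wt sk (G, P) :: ('u, 'e) einterp set) = herbrand_models wt sk (G, P)"
proof -
  let ?H = "herbrand_interps wt sk (G, P) :: ('u, 'e) einterp set"
  let ?V = "voc_ont sk (G, P)"
  have rigid: "I = J"
    if "I \<in> ?H" "J \<in> ?H" "models_graph I (skolemize sk G)" "I \<preceq> J" for I J
    by (rule total_herbrand_le_imp_eq)
      (use that herbrand_properties_total assms(3) in blast)+
  have rules: "interval_rules wt sk (G, P) M M = {r \<in> ground_program ?V P. models_body M (Cond r)}"
    if "M \<in> ?H" "models_graph M (skolemize sk G)" for M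
    using rigid[OF that(1) _ that(2)] that(1) interp_le_refl[of M]
    unfolding interval_rules_def by (auto simp del: models_body.simps)
  have iff: "(\<forall>r \<in> P. models_rule M r) \<longleftrightarrow>
      (\<forall>r \<in> interval_rules wt sk (G, P) M M. models_head M (Concl r))"
    if "M \<in> ?H" "models_graph M (skolemize sk G)" for M
    unfolding rules[OF that] by (auto simp: herbrand_models_rule_iff[OF that(1)] ground_program_def)
  show ?thesis
  proof
    show "(stable_models wt sk (G, P) :: ('u, 'e) einterp set) \<subseteq> herbrand_models wt sk (G, P)"
    proof
      fix M :: "('u, 'e) einterp"
      assume "M \<in> stable_models wt sk (G, P)"
      then obtain k :: nat and C where M: "M \<in> ?H"
        and C: "\<And>\<alpha>. \<alpha> \<le> k + 1 \<Longrightarrow> C \<alpha> \<in> ?H" "\<And>\<alpha>. \<alpha> \<le> k \<Longrightarrow> C \<alpha> \<preceq> C (\<alpha> + 1)"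
        and Ck: "C k = M" "C (k + 1) = M"
        and C0: "models_graph (C 0) (skolemize sk G)"
        and step: "\<forall>r \<in> interval_rules wt sk (G, P) (C k) M. models_head (C (k + 1)) (Concl r)"
      proof -
        obtain k :: nat and C where M: "M \<in> ?H"
          and C: "\<forall>\<alpha> \<le> k + 1. C \<alpha> \<in> ?H" "\<forall>\<alpha> \<le> k. C \<alpha> \<preceq> C (\<alpha> + 1)"
          and Ck: "C k = M" "C (k + 1) = M"
          and C0: "C 0 \<in> minimal {I \<in> ?H. models_graph I (skolemize sk (fst (G, P)))}"
          and step: "\<forall>\<alpha>. 0 < \<alpha> \<and> \<alpha> \<le> k + 1 \<longrightarrow>
             C \<alpha> \<in> minimal {I \<in> ?H. C (\<alpha> - 1) \<preceq> I \<and>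
               (\<forall>r \<in> interval_rules wt sk (G, P) (C (\<alpha> - 1)) M. models_head I (Concl r))}"
          using \<open>M \<in> stable_models wt sk (G, P)\<close> unfolding stable_models_def mem_Collect_eq
          by (elim conjE exE) (rule that)
        \<comment> \<open>The last link of the chain is the one whose two ends are both
          \<open>M\<close>; there the rules range over the interval from \<open>M\<close> to
          \<open>M\<close>.\<close>
        have "C (k + 1) \<in> minimal {I \<in> ?H. C k \<preceq> I \<and>
               (\<forall>r \<in> interval_rules wt sk (G, P) (C k) M. models_head I (Concl r))}"
          using spec[OF step, of "k + 1"] by simp
        then have "\<forall>r \<in> interval_rules wt sk (G, P) (C k) M. models_head (C (k + 1)) (Concl r)"
          by (simp add: minimal_def)
        moreover have "models_graph (C 0) (skolemize sk G)"
          using C0 by (simp add: minimal_def)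
        ultimately show thesis using that M C Ck by blast
      qed
      have const: "C \<alpha> = C 0" if "\<alpha> \<le> k" for \<alpha>
        using that
      proof (induction \<alpha>)
        case (Suc \<alpha>)
        then have "C \<alpha> = C 0" by simp
        \<comment> \<open>Rigidity needs the graph to hold at the lower end of the link, which is
          \<open>C 0\<close> by the induction hypothesis.\<close>
        moreover have "C \<alpha> = C (Suc \<alpha>)"
          using Suc C(1)[of \<alpha>] C(1)[of "Suc \<alpha>"] C(2)[of \<alpha>] C0 by (intro rigid) auto
        ultimately show ?case by simp
      qed simp
      have mg: "models_graph M (skolemize sk G)"
        using const[of k] C0 Ck(1) by simp
      show "M \<in> herbrand_models wt sk (G, P)"
        using M mg step iff[OF M mg] Ck
        by (simp add: herbrand_models_def models_ontology_def)
    qed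
    show "(herbrand_models wt sk (G, P) :: ('u, 'e) einterp set) \<subseteq> stable_models wt sk (G, P)"
    proof
      fix M :: "('u, 'e) einterp"
      assume "M \<in> herbrand_models wt sk (G, P)"
      then have M: "M \<in> ?H" and mg: "models_graph M (skolemize sk G)"
        and mr: "\<forall>r \<in> P. models_rule M r"
        by (auto simp: herbrand_models_def models_ontology_def)
      \<comment> \<open>Rigidity is applied to the competitor below \<open>M\<close>, which
        satisfies the graph by membership in the set.\<close>
      have "M \<in> minimal {I \<in> ?H. models_graph I (skolemize sk G)}"
        using M mg rigid unfolding minimal_def by blast
      \<comment> \<open>Here all candidates lie above \<open>M\<close> and so equal
        \<open>M\<close>; the content is that \<open>M\<close> satisfies the heads of its applicable
        ground rules, by \<open>iff\<close>.\<close>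
      moreover have "M \<in> minimal {I \<in> ?H. M \<preceq> I \<and>
          (\<forall>r \<in> interval_rules wt sk (G, P) M M. models_head I (Concl r))}"
        using M mg mr rigid iff[OF M mg] interp_le_refl unfolding minimal_def by blast
      \<comment> \<open>The witness is the constant chain with \<open>k = 0\<close>. Its only
        positive index is 1, so the two minimality facts are exactly its conditions.\<close>
      ultimately show "M \<in> stable_models wt sk (G, P)"
        unfolding stable_models_def using M interp_le_refl
        by (intro CollectI conjI exI[of _ 0] exI[of _ "\<lambda>_. M"]) simp_all
    qed
  qed
qed

end
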